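(* Let $G$ be a connected finite simple graph on $N\ge 3$ vertices with minimum degree $d\ge 3$, let $\mathbf{L}$ be its normalized Laplacian, and for a positive integer $l$ let $\mathbf{L}^{[l]}:=\mathbf{I}-(\mathbf{I}-\mathbf{L})^{l}$. Then there is an eigenvalue $\lambda^{[l]}$ of $\mathbf{L}^{[l]}$ with $$|1-\lambda^{[l]}|\le \Big(\frac{\sqrt{d-1}}{d}\Big)^l.$$ Moreover, when $l=2k$ is even, the largest eigenvalue $\lambda^{[2k]}_N$ of $\mathbf{L}^{[2k]}$ satisfies $$1-\frac{(d-1)^k}{d^{2k}}\le \lambda^{[2k]}_N\le 1,$$ and both bounds are sharp.
   Context: The normalized Laplacian of $G$ is $\mathbf{L}=\mathbf{I}-\mathbf{D}^{-1}\mathbf{A}$, where $\mathbf{A}$ is the adjacency matrix and $\mathbf{D}$ the diagonal degree matrix. The matrix $\mathbf{L}^{[l]}=\mathbf{I}-(\mathbf{I}-\mathbf{L})^l$ is the normalized Laplacian of the weighted neighborhood graph of order $l$ of $G$ (in the sense of Bauer and Jost). *)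

theory Defs
  imports
    "Graph_Theory.Digraph_Component"
    "Jordan_Normal_Form.Char_Poly"
    "Jordan_Normal_Form.Spectral_Radius"
begin

text \<open>
  A finite simple graph is a \<^locale>\<open>graph\<close>: a finite, loop-free, symmetric digraph without
  parallel arcs. An undirected edge is a pair of opposite arcs, so the degree of a vertex is its
  out-degree (equivalently, its in-degree).

  Matrices are indexed by positions in a list \<open>vs\<close> that enumerates the vertices without repetition.
\<close>

definition vertex_enum :: "('a, 'b) pre_digraph \<Rightarrow> 'a list \<Rightarrow> bool" where
  "vertex_enum G vs \<longleftrightarrow> distinct vs \<and> set vs = verts G"

definition min_degree :: "('a, 'b) pre_digraph \<Rightarrow> nat" where
  "min_degree G = Min (out_degree G ` verts G)"

definition adjacency_mat :: "('a, 'b) pre_digraph \<Rightarrow> 'a list \<Rightarrow> real mat" where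
  "adjacency_mat G vs =
     mat (length vs) (length vs) (\<lambda>(i, j). if vs ! i \<rightarrow>\<^bsub>G\<^esub> vs ! j then 1 else 0)"

definition degree_mat :: "('a, 'b) pre_digraph \<Rightarrow> 'a list \<Rightarrow> real mat" where
  "degree_mat G vs = mat_diag (length vs) (\<lambda>i. real (out_degree G (vs ! i)))"

definition degree_mat_inv :: "('a, 'b) pre_digraph \<Rightarrow> 'a list \<Rightarrow> real mat" where
  "degree_mat_inv G vs = mat_diag (length vs) (\<lambda>i. 1 / real (out_degree G (vs ! i)))"

lemma degree_mat_inv_inverts:
  assumes "\<And>v. v \<in> set vs \<Longrightarrow> out_degree G v > 0"
  shows "inverts_mat (degree_mat_inv G vs) (degree_mat G vs)"
    and "inverts_mat (degree_mat G vs) (degree_mat_inv G vs)"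
proof -
  have "out_degree G (vs ! i) \<noteq> 0" if "i < length vs" for i
    using assms[of "vs ! i"] that by simp
  then show "inverts_mat (degree_mat_inv G vs) (degree_mat G vs)"
    and "inverts_mat (degree_mat G vs) (degree_mat_inv G vs)"
    unfolding inverts_mat_def degree_mat_def degree_mat_inv_def mat_diag_diag
    by (auto simp: mat_diag_def intro!: eq_matI) (metis less_numeral_extra(3))+
qed

definition norm_laplacian :: "('a, 'b) pre_digraph \<Rightarrow> 'a list \<Rightarrow> real mat" where
  "norm_laplacian G vs = 1\<^sub>m (length vs) - degree_mat_inv G vs * adjacency_mat G vs"

definition nbhd_laplacian :: "('a, 'b) pre_digraph \<Rightarrow> 'a list \<Rightarrow> nat \<Rightarrow> real mat" where
  "nbhd_laplacian G vs l =
     1\<^sub>m (length vs) - (1\<^sub>m (length vs) - norm_laplacian G vs) ^\<^sub>m l"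

text \<open>
  All eigenvalues of these matrices are real, since the normalized Laplacian is similar to a
  symmetric matrix; so the largest eigenvalue is the maximum of the real spectrum.
\<close>

definition largest_eigenvalue :: "real mat \<Rightarrow> real" where
  "largest_eigenvalue M = Max (spectrum M)"

definition conn_graph_min_degree :: "('a, 'b) pre_digraph \<Rightarrow> 'a list \<Rightarrow> nat \<Rightarrow> bool" where
  "conn_graph_min_degree G vs d \<longleftrightarrow>
     graph G \<and> Digraph_Component.connected G \<and> vertex_enum G vs \<and> 3 \<le> card (verts G) \<and>
     min_degree G = d \<and> 3 \<le> d"

end

theory Submission
  imports Defs "HOL-Number_Theory.Cong"
begin

text \<open>
  Let \<open>P = D\<^sup>-\<^sup>1 A\<close>, \<open>e = 1/d\<close> and \<open>c = e - e\<^sup>2 = (d - 1)/d\<^sup>2\<close>. The spectrum of \<open>P\<close> is real and contained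
  in \<open>[-1, 1]\<close>, and the eigenvalues of the \<open>l\<close>-th neighbourhood Laplacian are the numbers \<open>1 - \<mu>\<^sup>l\<close> for
  \<open>\<mu>\<close> in that spectrum. To find \<open>\<mu>\<close> with \<open>\<mu>\<^sup>2 \<le> c\<close> it suffices that \<open>tr ((1 - P\<^sup>2) (P\<^sup>2 - c)) \<le> 0\<close>:
  otherwise every \<open>\<mu>\<^sup>2\<close> would be \<open>1\<close>, contradicting \<open>tr P\<^sup>2 \<le> n e < n\<close>. Put \<open>q u w = P u w * P w u\<close> and
  \<open>s u = \<Sum>w. q u w\<close>. The walks \<open>u w u z\<close> and \<open>u w v w\<close> give \<open>tr P\<^sup>4 \<ge> 2 \<Sum> s\<^sup>2 - \<Sum> q\<^sup>2\<close>, and the trace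
  inequality follows from \<open>s\<^sup>2 \<ge> 2 e s - e\<^sup>2\<close>, \<open>s \<le> e\<close>, \<open>q \<le> e\<^sup>2\<close> and \<open>e \<le> 1/3\<close>.

  The lower bound is attained by incidence graphs of projective planes of prime order \<open>p = d - 1\<close>,
  where \<open>P\<^sup>2\<close> has only the eigenvalues \<open>1\<close> and \<open>c\<close>, and the upper one by complete bipartite graphs,
  where \<open>P\<close> is singular.
\<close>

section \<open>Spectra of real matrices\<close>

definition mat_trace :: "'a :: comm_monoid_add mat \<Rightarrow> 'a" where
  "mat_trace M = (\<Sum>i<dim_row M. M $$ (i, i))"

lemma index_mult_mat_sum:
  assumes "M \<in> carrier_mat n m" "N \<in> carrier_mat m k" "i < n" "j < k"
  shows "(M * N) $$ (i, j) = (\<Sum>l<m. M $$ (i, l) * N $$ (l, j))"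
  using assms by (auto simp: scalar_prod_def lessThan_atLeast0)

lemma index_mult_mat_vec_sum:
  assumes "M \<in> carrier_mat n m" "v \<in> carrier_vec m" "i < n"
  shows "(M *\<^sub>v v) $ i = (\<Sum>l<m. M $$ (i, l) * v $ l)"
  using assms by (auto simp: scalar_prod_def lessThan_atLeast0)

lemma mat_trace_mult:
  assumes "M \<in> carrier_mat n m" "N \<in> carrier_mat m n"
  shows "mat_trace (M * N) = (\<Sum>i<n. \<Sum>j<m. M $$ (i, j) * N $$ (j, i))"
  using assms index_mult_mat_sum[OF assms]
  by (simp add: mat_trace_def)

lemma mat_trace_mult_commute:
  fixes M N :: "'a :: comm_semiring_0 mat"
  assumes "M \<in> carrier_mat n m" "N \<in> carrier_mat m n"
  shows "mat_trace (M * N) = mat_trace (N * M)"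
  unfolding mat_trace_mult[OF assms] mat_trace_mult[OF assms(2,1)]
  by (subst sum.swap) (simp add: mult.commute)

lemma mat_trace_similar:
  fixes M N :: "'a :: comm_semiring_1 mat"
  assumes "M \<in> carrier_mat n n" "similar_mat_wit M N S T"
  shows "mat_trace M = mat_trace N"
proof -
  note w = similar_mat_witD2[OF assms]
  have "mat_trace M = mat_trace ((S * N) * T)" using w by simp
  also have "\<dots> = mat_trace (T * (S * N))"
    by (rule mat_trace_mult_commute) (use w in auto)
  also have "T * (S * N) = (T * S) * N"
    using w by (intro assoc_mult_mat[symmetric]) auto
  also have "\<dots> = N" using w by simp
  finally show ?thesis .
qed

text \<open>In entry \<open>(i, j)\<close> of a product of upper triangular matrices, the summand
  with middle index \<open>l\<close> can be nonzero only if \<open>i \<le> l \<le> j\<close>. This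
  leaves nothing below the diagonal and the single summand \<open>l = i\<close> on it.\<close>

lemma upper_triangular_pow_mat:
  fixes U :: "'a :: semiring_1 mat"
  assumes "U \<in> carrier_mat n n" "upper_triangular U"
  shows "upper_triangular (U ^\<^sub>m k) \<and> (\<forall>i<n. (U ^\<^sub>m k) $$ (i, i) = (U $$ (i, i)) ^ k)"
proof (induction k)
  case 0
  then show ?case using assms by auto
next
  case (Suc k)
  define V where "V = U ^\<^sub>m k"
  have V: "V \<in> carrier_mat n n" using assms(1) by (simp add: V_def)
  have V0: "V $$ (i, j) = 0" if "j < i" "i < n" for i j
    using Suc that V unfolding V_def[symmetric] by auto
  have U0: "U $$ (i, j) = 0" if "j < i" "i < n" for i j
    using assms that by auto
  have "(V * U) $$ (i, j) = 0" if "j < i" "i < n" for i j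
  proof -
    have "V $$ (i, l) * U $$ (l, j) = 0" if "l < n" for l
      using V0[of l i] U0[of j l] \<open>j < i\<close> \<open>i < n\<close> that by (cases "l < i") auto
    then show ?thesis
      using that by (subst index_mult_mat_sum[OF V assms(1)]) auto
  qed
  moreover have "(V * U) $$ (i, i) = V $$ (i, i) * U $$ (i, i)" if "i < n" for i
  proof -
    have "V $$ (i, l) * U $$ (l, i) = 0" if "l < n" "l \<noteq> i" for l
      using V0[of l i] U0[of i l] \<open>i < n\<close> that by (cases "l < i") auto
    then have "(\<Sum>l<n. V $$ (i, l) * U $$ (l, i)) = (\<Sum>l\<in>{i}. V $$ (i, l) * U $$ (l, i))"
      using that by (intro sum.mono_neutral_right) auto
    then show ?thesis
      using that by (subst index_mult_mat_sum[OF V assms(1)]) auto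
  qed
  moreover have "\<forall>i<n. V $$ (i, i) = U $$ (i, i) ^ k" using Suc by (simp add: V_def)
  ultimately show ?case
    using V assms(1) by (auto simp: V_def[symmetric] power_commutes)
qed

lemma eigenvalue_upper_triangular:
  fixes U :: "'a :: field mat"
  assumes "U \<in> carrier_mat n n" "upper_triangular U"
  shows "eigenvalue U x \<longleftrightarrow> (\<exists>i<n. x = U $$ (i, i))"
proof -
  have "eigenvalue U x \<longleftrightarrow> poly (\<Prod>a\<leftarrow>diag_mat U. [:- a, 1:]) x = 0"
    unfolding eigenvalue_root_char_poly[OF assms(1)] char_poly_upper_triangular[OF assms] ..
  also have "\<dots> \<longleftrightarrow> x \<in> set (diag_mat U)"
    by (induction "diag_mat U" rule: list.induct)
       (auto simp: poly_prod_list prod_list_zero_iff image_iff)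
  also have "\<dots> \<longleftrightarrow> (\<exists>i<n. x = U $$ (i, i))"
    using assms(1) by (auto simp: diag_mat_def)
  finally show ?thesis .
qed

text \<open>One Schur form \<open>U\<close> serves all powers at once, because
  \<open>M ^\<^sub>m k\<close> is similar to \<open>U ^\<^sub>m k\<close>. Its diagonal lists the
  eigenvalues with multiplicity, so the same family \<open>a\<close> governs every spectrum and
  every trace.\<close>

lemma complex_power_spectrum:
  fixes M :: "complex mat"
  assumes M: "M \<in> carrier_mat n n"
  obtains a where "\<And>k x. eigenvalue (M ^\<^sub>m k) x \<longleftrightarrow> (\<exists>i<n. x = a i ^ k)"
    and "\<And>k. mat_trace (M ^\<^sub>m k) = (\<Sum>i<n. a i ^ k)"
proof -
  from char_poly_factorized[OF M] obtain es where
    es: "char_poly M = (\<Prod>a\<leftarrow>es. [:- a, 1:])" by auto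
  obtain U S T where "schur_decomposition M es = (U, S, T)" by (metis prod_cases3)
  from schur_decomposition[OF M es this]
  have w: "similar_mat_wit M U S T" and ut: "upper_triangular U" by auto
  have U: "U \<in> carrier_mat n n" using similar_mat_witD2[OF M w] by auto
  have Uk: "U ^\<^sub>m k \<in> carrier_mat n n" and Mk: "M ^\<^sub>m k \<in> carrier_mat n n" for k
    using U M by auto
  note tri = upper_triangular_pow_mat[OF U ut]
  note wk = similar_mat_wit_pow[OF w]
  show thesis
  proof
    fix k x
    have "eigenvalue (M ^\<^sub>m k) x \<longleftrightarrow> eigenvalue (U ^\<^sub>m k) x"
      unfolding eigenvalue_root_char_poly[OF Uk] eigenvalue_root_char_poly[OF Mk]
      using char_poly_similar[of "M ^\<^sub>m k" "U ^\<^sub>m k"] wk[of k] unfolding similar_mat_def by metis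
    also have "\<dots> \<longleftrightarrow> (\<exists>i<n. x = (U $$ (i, i)) ^ k)"
      using eigenvalue_upper_triangular[OF Uk] tri by auto
    finally show "eigenvalue (M ^\<^sub>m k) x \<longleftrightarrow> (\<exists>i<n. x = (U $$ (i, i)) ^ k)" .
  next
    fix k
    show "mat_trace (M ^\<^sub>m k) = (\<Sum>i<n. (U $$ (i, i)) ^ k)"
      unfolding mat_trace_similar[OF Mk wk] using tri[of k] Uk[of k] by (auto simp: mat_trace_def)
  qed
qed

lemma eigenvalue_of_real_iff:
  fixes M :: "real mat"
  assumes M: "M \<in> carrier_mat n n"
  shows "eigenvalue (map_mat complex_of_real M) (complex_of_real x) \<longleftrightarrow> eigenvalue M x"
proof -
  have C: "map_mat complex_of_real M \<in> carrier_mat n n" using M by simp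
  show ?thesis
    unfolding eigenvalue_root_char_poly[OF M] eigenvalue_root_char_poly[OF C]
      of_real_hom.char_poly_hom[OF M] of_real_hom.poly_map_poly by simp
qed

text \<open>The triangular form of the complexified matrix has eigenvalues of \<open>M\<close> on
  its diagonal, as the case \<open>k = 1\<close> shows. These are real by assumption, so their real
  parts serve as the family \<open>a\<close>.\<close>

lemma real_power_spectrum:
  fixes M :: "real mat"
  assumes M: "M \<in> carrier_mat n n"
    and real: "\<And>z. eigenvalue (map_mat complex_of_real M) z \<Longrightarrow> z \<in> \<real>"
  obtains a where "\<And>k x. eigenvalue (M ^\<^sub>m k) x \<longleftrightarrow> (\<exists>i<n. x = a i ^ k)"
    and "\<And>k. mat_trace (M ^\<^sub>m k) = (\<Sum>i<n. a i ^ k)"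
proof -
  let ?C = "map_mat complex_of_real"
  have C: "?C M \<in> carrier_mat n n" using M by simp
  have Mk: "M ^\<^sub>m k \<in> carrier_mat n n" for k using M by simp
  have hom: "?C M ^\<^sub>m k = ?C (M ^\<^sub>m k)" for k
    by (rule of_real_hom.mat_hom_pow[OF M, symmetric])
  obtain a where a: "\<And>k x. eigenvalue (?C M ^\<^sub>m k) x \<longleftrightarrow> (\<exists>i<n. x = a i ^ k)"
    and t: "\<And>k. mat_trace (?C M ^\<^sub>m k) = (\<Sum>i<n. a i ^ k)"
    using complex_power_spectrum[OF C] by blast
  have ra: "a i = of_real (Re (a i))" if "i < n" for i
  proof -
    have "eigenvalue (?C M ^\<^sub>m 1) (a i)" unfolding a using that by auto
    then have "a i \<in> \<real>" using real C by simp
    then show ?thesis by (simp add: of_real_Re)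
  qed
  then have ra': "a i ^ k = of_real (Re (a i) ^ k)" if "i < n" for i k
    using that by (metis of_real_power)
  show thesis
  proof
    fix k x
    have "eigenvalue (M ^\<^sub>m k) x \<longleftrightarrow> (\<exists>i<n. complex_of_real x = a i ^ k)"
      using eigenvalue_of_real_iff[OF Mk] a hom by metis
    also have "\<dots> \<longleftrightarrow> (\<exists>i<n. x = Re (a i) ^ k)"
      using ra' by (metis of_real_eq_iff)
    finally show "eigenvalue (M ^\<^sub>m k) x \<longleftrightarrow> (\<exists>i<n. x = Re (a i) ^ k)" .
  next
    fix k
    have "complex_of_real (mat_trace N) = mat_trace (?C N)" if "N \<in> carrier_mat n n" for N
      using that by (simp add: mat_trace_def)
    then have "complex_of_real (mat_trace (M ^\<^sub>m k)) = mat_trace (?C (M ^\<^sub>m k))"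
      using Mk by blast
    also have "\<dots> = (\<Sum>i<n. a i ^ k)" unfolding hom[symmetric] t ..
    also have "\<dots> = (\<Sum>i<n. of_real (Re (a i) ^ k))" by (intro sum.cong) (auto simp: ra')
    finally have "complex_of_real (mat_trace (M ^\<^sub>m k)) = of_real (\<Sum>i<n. Re (a i) ^ k)" by simp
    then show "mat_trace (M ^\<^sub>m k) = (\<Sum>i<n. Re (a i) ^ k)"
      using of_real_eq_iff by blast
  qed
qed

section \<open>Reversible and stochastic matrices: real spectrum inside [-1, 1]\<close>

text \<open>Detailed balance makes \<open>M\<close> self-adjoint for the inner product with weights
  \<open>w\<close>. For an eigenvector \<open>v\<close>, the form \<open>Q\<close> of
  \<open>M\<close> at \<open>v\<close> equals its own conjugate and is \<open>z\<close> times the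
  positive weighted norm \<open>S\<close>.\<close>

lemma reversible_eigenvalue_real:
  fixes M :: "real mat"
  assumes M: "M \<in> carrier_mat n n"
    and pos: "\<And>i. i < n \<Longrightarrow> w i > 0"
    and rev: "\<And>i j. i < n \<Longrightarrow> j < n \<Longrightarrow> w i * M $$ (i, j) = w j * M $$ (j, i)"
    and ev: "eigenvalue (map_mat complex_of_real M) z"
  shows "z \<in> \<real>"
proof -
  let ?C = "map_mat complex_of_real M"
  have C: "?C \<in> carrier_mat n n" using M by simp
  from ev obtain v where v: "v \<in> carrier_vec n" "v \<noteq> 0\<^sub>v n" "?C *\<^sub>v v = z \<cdot>\<^sub>v v"
    using M by (auto simp: eigenvalue_def eigenvector_def)
  have eq: "(\<Sum>j<n. of_real (M $$ (i, j)) * v $ j) = z * v $ i" if "i < n" for i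
  proof -
    have "(\<Sum>j<n. ?C $$ (i, j) * v $ j) = (?C *\<^sub>v v) $ i"
      using index_mult_mat_vec_sum[OF C v(1) that] by simp
    then show ?thesis using v that M by simp
  qed
  define S where "S = (\<Sum>i<n. w i * (cmod (v $ i))\<^sup>2)"
  define Q where "Q = (\<Sum>i<n. \<Sum>j<n. of_real (w i * M $$ (i, j)) * v $ j * cnj (v $ i))"
  have "z * of_real S = (\<Sum>i<n. of_real (w i) * (z * v $ i) * cnj (v $ i))"
    unfolding S_def of_real_sum sum_distrib_left of_real_mult complex_norm_square of_real_power
    by (intro sum.cong) (auto simp: mult_ac complex_norm_square[symmetric])
  also have "\<dots> = Q"
    unfolding Q_def by (intro sum.cong) (auto simp: eq[symmetric] sum_distrib_left sum_distrib_right mult_ac)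
  finally have zS: "z * of_real S = Q" .
  have "cnj Q = (\<Sum>i<n. \<Sum>j<n. of_real (w i * M $$ (i, j)) * cnj (v $ j) * v $ i)"
    unfolding Q_def by simp
  also have "\<dots> = (\<Sum>j<n. \<Sum>i<n. of_real (w j * M $$ (j, i)) * v $ i * cnj (v $ j))"
    by (subst sum.swap, intro sum.cong refl) (use rev in \<open>auto simp: mult_ac\<close>)
  finally have "cnj Q = Q" unfolding Q_def .
  then have Q: "Q \<in> \<real>" by (simp add: Reals_cnj_iff)
  obtain i where i: "i < n" "v $ i \<noteq> 0" using v(1,2) by (metis carrier_vecD eq_vecI index_zero_vec(1,2))
  have "0 < w i * (cmod (v $ i))\<^sup>2" using i pos by simp
  also have "\<dots> \<le> S" unfolding S_def
    by (rule member_le_sum) (use i pos in \<open>auto simp: less_imp_le\<close>)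
  finally have "S > 0" .
  then have "z = Q / of_real S" using zS by (simp add: field_simps)
  then show ?thesis using Q by auto
qed

text \<open>Maximum principle: at a coordinate \<open>k\<close> where the eigenvector has its
  largest modulus \<open>m\<close>, the product with \<open>M\<close> is an average of values of
  modulus at most \<open>m\<close>.\<close>

lemma stochastic_eigenvalue_le_1:
  fixes M :: "real mat"
  assumes M: "M \<in> carrier_mat n n"
    and nonneg: "\<And>i j. i < n \<Longrightarrow> j < n \<Longrightarrow> M $$ (i, j) \<ge> 0"
    and row: "\<And>i. i < n \<Longrightarrow> (\<Sum>j<n. M $$ (i, j)) = 1"
    and ev: "eigenvalue M x"
  shows "\<bar>x\<bar> \<le> 1"
proof -
  from ev obtain v where v: "v \<in> carrier_vec n" "v \<noteq> 0\<^sub>v n" "M *\<^sub>v v = x \<cdot>\<^sub>v v"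
    using M by (auto simp: eigenvalue_def eigenvector_def)
  obtain i where i: "i < n" "v $ i \<noteq> 0" using v(1,2) by (metis carrier_vecD eq_vecI index_zero_vec(1,2))
  define m where "m = Max ((\<lambda>j. \<bar>v $ j\<bar>) ` {..<n})"
  have m: "\<bar>v $ j\<bar> \<le> m" if "j < n" for j unfolding m_def using that by (intro Max_ge) auto
  have "m \<in> (\<lambda>j. \<bar>v $ j\<bar>) ` {..<n}" unfolding m_def using i by (intro Max_in) auto
  then obtain k where k: "k < n" "m = \<bar>v $ k\<bar>" by auto
  have "m > 0" using m[OF i(1)] i by linarith
  have "x * v $ k = (\<Sum>j<n. M $$ (k, j) * v $ j)"
    using index_mult_mat_vec_sum[OF M v(1) k(1)] v k by simp
  then have "\<bar>x\<bar> * m = \<bar>\<Sum>j<n. M $$ (k, j) * v $ j\<bar>" by (simp add: k(2) abs_mult[symmetric])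
  also have "\<dots> \<le> (\<Sum>j<n. M $$ (k, j) * m)"
    by (rule order.trans[OF sum_abs], rule sum_mono)
       (use nonneg k m in \<open>auto simp: abs_mult intro!: mult_left_mono\<close>)
  also have "\<dots> = m" using row[OF k(1)] by (simp add: sum_distrib_right[symmetric])
  finally show ?thesis using \<open>m > 0\<close> by simp
qed

section \<open>The trace inequality and the small eigenvalue\<close>

text \<open>Only the closed walks of length four that traverse one or two edges are counted.\<close>

lemma trace_pow4_lower_bound:
  fixes p :: "'a \<Rightarrow> 'a \<Rightarrow> real"
  assumes "finite I" and nonneg: "\<And>u v. u \<in> I \<Longrightarrow> v \<in> I \<Longrightarrow> p u v \<ge> 0"
  defines "q \<equiv> \<lambda>u v. p u v * p v u"
  shows "2 * (\<Sum>u\<in>I. (\<Sum>w\<in>I. q u w)\<^sup>2) - (\<Sum>u\<in>I. \<Sum>w\<in>I. (q u w)\<^sup>2)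
    \<le> (\<Sum>u\<in>I. \<Sum>v\<in>I. (\<Sum>w\<in>I. p u w * p w v) * (\<Sum>w\<in>I. p v w * p w u))"
proof -
  have qs: "q u v = q v u" for u v by (simp add: q_def)
  \<comment> \<open>For \<open>v = u\<close> this is an equality: the product is the full square of
    the row sum of \<open>q\<close>, and the \<open>if\<close> term adds what the first sum misses.
    For \<open>v \<noteq> u\<close> only the summands with the same middle vertex in both factors
    are kept.\<close>
  have "(\<Sum>w\<in>I. q u w * q w v) + (if v = u then (\<Sum>w\<in>I. q u w)\<^sup>2 - (\<Sum>w\<in>I. (q u w)\<^sup>2) else 0)
    \<le> (\<Sum>w\<in>I. p u w * p w v) * (\<Sum>w\<in>I. p v w * p w u)" if uv: "u \<in> I" "v \<in> I" for u v
  proof (cases "v = u")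
    case True
    then show ?thesis by (simp add: q_def power2_eq_square qs mult_ac)
  next
    case False
    have "(\<Sum>w\<in>I. q u w * q w v) = (\<Sum>w\<in>I. (p u w * p w v) * (p v w * p w u))"
      by (simp add: q_def mult_ac)
    also have "\<dots> \<le> (\<Sum>w\<in>I. (p u w * p w v) * (\<Sum>z\<in>I. p v z * p z u))"
      using uv nonneg \<open>finite I\<close>
      by (intro sum_mono mult_left_mono member_le_sum) auto
    also have "\<dots> = (\<Sum>w\<in>I. p u w * p w v) * (\<Sum>w\<in>I. p v w * p w u)"
      by (simp add: sum_distrib_right)
    finally show ?thesis using False by simp
  qed
  then have "(\<Sum>u\<in>I. \<Sum>v\<in>I. (\<Sum>w\<in>I. q u w * q w v) +
      (if v = u then (\<Sum>w\<in>I. q u w)\<^sup>2 - (\<Sum>w\<in>I. (q u w)\<^sup>2) else 0))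
    \<le> (\<Sum>u\<in>I. \<Sum>v\<in>I. (\<Sum>w\<in>I. p u w * p w v) * (\<Sum>w\<in>I. p v w * p w u))"
    by (intro sum_mono)
  also have "(\<Sum>u\<in>I. \<Sum>v\<in>I. (\<Sum>w\<in>I. q u w * q w v) +
      (if v = u then (\<Sum>w\<in>I. q u w)\<^sup>2 - (\<Sum>w\<in>I. (q u w)\<^sup>2) else 0))
    = (\<Sum>u\<in>I. \<Sum>v\<in>I. \<Sum>w\<in>I. q u w * q w v) + (\<Sum>u\<in>I. (\<Sum>w\<in>I. q u w)\<^sup>2 - (\<Sum>w\<in>I. (q u w)\<^sup>2))"
    using \<open>finite I\<close> by (simp add: sum.distrib)
  \<comment> \<open>Summing over the middle vertex \<open>w\<close> last and using the symmetry of
    \<open>q\<close> gives a second copy of the sum of squared row sums, hence the factor 2 in the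
    claim.\<close>
  also have "(\<Sum>u\<in>I. \<Sum>v\<in>I. \<Sum>w\<in>I. q u w * q w v) = (\<Sum>w\<in>I. (\<Sum>u\<in>I. q w u)\<^sup>2)"
  proof -
    have "(\<Sum>u\<in>I. \<Sum>v\<in>I. \<Sum>w\<in>I. q u w * q w v) = (\<Sum>u\<in>I. \<Sum>w\<in>I. \<Sum>v\<in>I. q u w * q w v)"
      by (intro sum.cong refl sum.swap)
    also have "\<dots> = (\<Sum>w\<in>I. \<Sum>u\<in>I. \<Sum>v\<in>I. q w u * q w v)"
      by (subst sum.swap) (simp add: qs)
    finally show ?thesis by (simp add: power2_eq_square sum_product)
  qed
  finally show ?thesis by (simp add: sum_subtractf)
qed

text \<open>If every squared eigenvalue exceeded \<open>c\<close>, each summand of the trace would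
  be nonnegative while the total is at most 0. Then all squares would equal 1 and the trace of the
  squared matrix would be \<open>n\<close>, more than the bound \<open>e * n\<close> allows.\<close>

lemma stochastic_small_eigenvalue:
  fixes M :: "real mat"
  assumes M: "M \<in> carrier_mat n n" and "n > 0"
    and nonneg: "\<And>i j. i < n \<Longrightarrow> j < n \<Longrightarrow> M $$ (i, j) \<ge> 0"
    and row: "\<And>i. i < n \<Longrightarrow> (\<Sum>j<n. M $$ (i, j)) = 1"
    and entry: "\<And>i j. i < n \<Longrightarrow> j < n \<Longrightarrow> M $$ (i, j) \<le> e"
    and e: "0 < e" "e \<le> 1 / 3"
    and real: "\<And>z. eigenvalue (map_mat complex_of_real M) z \<Longrightarrow> z \<in> \<real>"
  obtains x where "eigenvalue M x" "x\<^sup>2 \<le> e - e\<^sup>2"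
proof (rule ccontr)
  assume nothesis: "\<not> thesis"
  define c where "c = e - e\<^sup>2"
  obtain a where ev: "\<And>k x. eigenvalue (M ^\<^sub>m k) x \<longleftrightarrow> (\<exists>i<n. x = a i ^ k)"
    and tr: "\<And>k. mat_trace (M ^\<^sub>m k) = (\<Sum>i<n. a i ^ k)"
    using real_power_spectrum[OF M real] by blast
  have eva: "eigenvalue M (a i)" if "i < n" for i
    using ev[of 1 "a i"] that M by auto
  have lo: "(a i)\<^sup>2 > c" if "i < n" for i
    using eva[OF that] nothesis \<open>\<And>x. _ \<Longrightarrow> _ \<Longrightarrow> thesis\<close> by (force simp: c_def)
  have hi: "(a i)\<^sup>2 \<le> 1" if "i < n" for i
    using stochastic_eigenvalue_le_1[OF M nonneg row eva[OF that]] by (simp add: abs_square_le_1)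
  define p where "p = (\<lambda>i j. M $$ (i, j))"
  define q where "q = (\<lambda>i j. p i j * p j i)"
  define s where "s = (\<lambda>i. \<Sum>j<n. q i j)"
  have M2: "M ^\<^sub>m 2 = M * M" using M by (simp add: numeral_2_eq_2)
  have M4: "M ^\<^sub>m 4 = (M * M) * (M * M)"
    using M by (simp add: numeral_eq_Suc assoc_mult_mat[of _ n n _ n _ n])
  have MM: "M * M \<in> carrier_mat n n" using M by auto
  have t2: "mat_trace (M ^\<^sub>m 2) = (\<Sum>i<n. s i)"
    unfolding M2 mat_trace_mult[OF M M] by (simp add: s_def q_def p_def)
  have "mat_trace (M ^\<^sub>m 4) = (\<Sum>u<n. \<Sum>v<n. (\<Sum>w<n. p u w * p w v) * (\<Sum>w<n. p v w * p w u))"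
    unfolding M4 mat_trace_mult[OF MM MM]
    by (intro sum.cong refl) (simp add: index_mult_mat_sum[OF M M] p_def)
  then have t4: "mat_trace (M ^\<^sub>m 4) \<ge> 2 * (\<Sum>u<n. (s u)\<^sup>2) - (\<Sum>u<n. \<Sum>w<n. (q u w)\<^sup>2)"
    using trace_pow4_lower_bound[of "{..<n}" p] nonneg by (simp add: p_def q_def s_def)
  have q: "0 \<le> q i j" "q i j \<le> e * p i j" "p i j \<le> e" if "i < n" "j < n" for i j
    using that nonneg[of i j] nonneg[of j i] entry[of i j] entry[of j i]
    by (auto simp: q_def p_def mult.commute[of e] intro!: mult_left_mono)
  have se: "s i \<le> e" if "i < n" for i
  proof -
    have "s i \<le> (\<Sum>j<n. e * p i j)" unfolding s_def using q that by (intro sum_mono) auto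
    also have "\<dots> = e" using row[OF that] by (simp add: p_def sum_distrib_left[symmetric])
    finally show ?thesis .
  qed
  have qsq: "(q i j)\<^sup>2 \<le> e\<^sup>2 * q i j" if "i < n" "j < n" for i j
  proof -
    have "q i j \<le> e * e" using q[OF that] mult_left_mono[of "p i j" e e] e by linarith
    then have "q i j * q i j \<le> e * e * q i j" using q[OF that] by (intro mult_right_mono)
    then show ?thesis by (simp add: power2_eq_square)
  qed
  define \<sigma> where "\<sigma> = (\<Sum>i<n. s i)"
  have \<sigma>: "\<sigma> \<le> e * n" unfolding \<sigma>_def using sum_mono[of "{..<n}" s "\<lambda>_. e"] se by (simp add: mult.commute)
  \<comment> \<open>The tangent to the square at \<open>e\<close> replaces the quadratic term by one
    that is linear in \<open>\<sigma>\<close>.\<close>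
  have "(\<Sum>i<n. 2 * e * s i - e\<^sup>2) \<le> (\<Sum>i<n. (s i)\<^sup>2)"
    by (intro sum_mono) (use zero_le_power2[of "s _ - e"] in \<open>simp add: power2_diff algebra_simps\<close>)
  then have b1: "2 * e * \<sigma> - n * e\<^sup>2 \<le> (\<Sum>i<n. (s i)\<^sup>2)"
    by (simp add: \<sigma>_def sum_subtractf sum_distrib_left)
  have "(\<Sum>i<n. \<Sum>j<n. (q i j)\<^sup>2) \<le> (\<Sum>i<n. \<Sum>j<n. e\<^sup>2 * q i j)"
    by (intro sum_mono) (use qsq in auto)
  then have b2: "(\<Sum>i<n. \<Sum>j<n. (q i j)\<^sup>2) \<le> e\<^sup>2 * \<sigma>"
    by (simp add: \<sigma>_def s_def sum_distrib_left)
  \<comment> \<open>This is where \<open>e \<le> 1 / 3\<close> enters: the final estimate has slope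
    \<open>1 - 3 * e\<close> in \<open>\<sigma>\<close>, which must be nonnegative.\<close>
  have b3: "(1 - 3 * e) * \<sigma> \<le> (1 - 3 * e) * (e * n)"
    using e \<sigma> by (intro mult_left_mono) auto
  \<comment> \<open>A statement about plain reals, so that the sums and traces are opaque atoms for
    linear arithmetic.\<close>
  have bound: "z - t - r \<le> z - 2 * x + y - r" if "2 * A - Q \<le> t" "x \<le> A" "Q \<le> y"
    for z t r x y A Q :: real
    using that by linarith
  have "(\<Sum>i<n. (1 - (a i)\<^sup>2) * ((a i)\<^sup>2 - c)) = (1 + c) * (\<Sum>i<n. (a i)\<^sup>2) - (\<Sum>i<n. (a i) ^ 4) - c * n"
    by (simp add: sum_subtractf sum.distrib sum_distrib_left algebra_simps power4_eq_xxxx power2_eq_square)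
  also have "\<dots> = (1 + c) * \<sigma> - mat_trace (M ^\<^sub>m 4) - c * n"
    using tr[of 2] tr[of 4] t2 by (simp add: \<sigma>_def)
  also have "\<dots> \<le> (1 + c) * \<sigma> - 2 * (2 * e * \<sigma> - n * e\<^sup>2) + e\<^sup>2 * \<sigma> - c * n"
    by (rule bound[OF t4 b1 b2])
  \<comment> \<open>The choice of \<open>c\<close> is made for this line: it is the value for which
    the bound, affine in \<open>\<sigma>\<close>, vanishes at the largest possible
    \<open>\<sigma> = e * n\<close>.\<close>
  also have "\<dots> = (1 - 3 * e) * \<sigma> - (1 - 3 * e) * (e * n)"
    by (simp add: c_def algebra_simps power2_eq_square)
  also have "\<dots> \<le> 0" using b3 by simp
  finally have le0: "(\<Sum>i<n. (1 - (a i)\<^sup>2) * ((a i)\<^sup>2 - c)) \<le> 0" .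
  have nn: "0 \<le> (1 - (a i)\<^sup>2) * ((a i)\<^sup>2 - c)" if "i < n" for i
    using lo[OF that] hi[OF that] by (intro mult_nonneg_nonneg) auto
  have "(\<Sum>i<n. (1 - (a i)\<^sup>2) * ((a i)\<^sup>2 - c)) = 0"
    using le0 nn by (intro antisym sum_nonneg) auto
  then have "(1 - (a i)\<^sup>2) * ((a i)\<^sup>2 - c) = 0" if "i < n" for i
    using nn that by (subst (asm) sum_nonneg_eq_0_iff) auto
  then have "(a i)\<^sup>2 = 1" if "i < n" for i
    using lo[OF that] that by fastforce
  then have "\<sigma> = n" using tr[of 2] t2 by (simp add: \<sigma>_def)
  then have "real n \<le> e * n" using \<sigma> by simp
  then show False using e \<open>n > 0\<close> by simp
qed

section \<open>The random walk matrix of a graph\<close>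

definition walk_mat :: "('a, 'b) pre_digraph \<Rightarrow> 'a list \<Rightarrow> real mat" where
  "walk_mat G vs = degree_mat_inv G vs * adjacency_mat G vs"

lemma walk_mat_carrier: "walk_mat G vs \<in> carrier_mat (length vs) (length vs)"
  by (auto simp: walk_mat_def degree_mat_inv_def adjacency_mat_def
      intro!: mult_carrier_mat[of _ _ "length vs"])

lemma walk_mat_index:
  assumes "i < length vs" "j < length vs"
  shows "walk_mat G vs $$ (i, j) =
    (if vs ! i \<rightarrow>\<^bsub>G\<^esub> vs ! j then 1 / real (out_degree G (vs ! i)) else 0)"
  using assms mat_diag_mult_left[of "adjacency_mat G vs" "length vs" "length vs"]
  by (simp add: walk_mat_def degree_mat_inv_def adjacency_mat_def)

lemma nbhd_laplacian_eq:
  "nbhd_laplacian G vs l = 1\<^sub>m (length vs) - walk_mat G vs ^\<^sub>m l"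
proof -
  have "1\<^sub>m (length vs) - norm_laplacian G vs = walk_mat G vs"
    using walk_mat_carrier[of G vs]
    by (auto simp: norm_laplacian_def walk_mat_def[symmetric])
  then show ?thesis by (simp add: nbhd_laplacian_def)
qed

text \<open>Both matrices have the same eigenvectors, and the eigenvalue is reflected at
  1/2.\<close>

lemma eigenvalue_one_minus:
  fixes M :: "'a :: comm_ring_1 mat"
  assumes M: "M \<in> carrier_mat n n"
  shows "eigenvalue (1\<^sub>m n - M) x \<longleftrightarrow> eigenvalue M (1 - x)"
proof -
  have "(1\<^sub>m n - M) *\<^sub>v v = x \<cdot>\<^sub>v v \<longleftrightarrow> M *\<^sub>v v = (1 - x) \<cdot>\<^sub>v v" if v: "v \<in> carrier_vec n" for v
  proof -
    have "(1\<^sub>m n - M) *\<^sub>v v = v - M *\<^sub>v v"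
      using M v by (simp add: minus_mult_distrib_mat_vec[of _ n n])
    moreover have "v - M *\<^sub>v v = x \<cdot>\<^sub>v v \<longleftrightarrow> M *\<^sub>v v = (1 - x) \<cdot>\<^sub>v v"
      using M v by (auto simp: vec_eq_iff algebra_simps)
    ultimately show ?thesis by simp
  qed
  then show ?thesis using M by (auto simp: eigenvalue_def eigenvector_def)
qed

text \<open>Without parallel arcs, \<open>head\<close> is injective on the arcs leaving
  \<open>v\<close>, so counting arcs is counting neighbours.\<close>

lemma out_degree_eq_card_successors:
  assumes "graph G"
  shows "out_degree G v = card {w. v \<rightarrow>\<^bsub>G\<^esub> w}"
proof -
  interpret graph G by fact
  have "bij_betw (head G) (out_arcs G v) {w. v \<rightarrow>\<^bsub>G\<^esub> w}"
    unfolding bij_betw_def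
    by (auto simp: inj_on_def out_arcs_def arcs_ends_def arc_to_ends_def intro: no_multi_arcs)
  then show ?thesis unfolding out_degree_def by (rule bij_betw_same_card)
qed

lemma sum_adjacency_row:
  assumes "graph G" "vertex_enum G vs"
  shows "(\<Sum>j<length vs. if v \<rightarrow>\<^bsub>G\<^esub> vs ! j then 1 else 0) = real (out_degree G v)"
proof -
  interpret graph G by fact
  have vs: "distinct vs" "set vs = verts G" using assms by (auto simp: vertex_enum_def)
  have "(\<Sum>j<length vs. if v \<rightarrow>\<^bsub>G\<^esub> vs ! j then 1 else 0) = (\<Sum>w\<in>verts G. if v \<rightarrow>\<^bsub>G\<^esub> w then 1 else 0 :: real)"
    using bij_betw_nth[OF vs(1) refl vs(2)[symmetric]] by (rule sum.reindex_bij_betw)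
  also have "\<dots> = real (card {w \<in> verts G. v \<rightarrow>\<^bsub>G\<^esub> w})"
    using sum.inter_filter[of "verts G" "\<lambda>_. 1::real" "\<lambda>w. v \<rightarrow>\<^bsub>G\<^esub> w"] by simp
  also have "{w \<in> verts G. v \<rightarrow>\<^bsub>G\<^esub> w} = {w. v \<rightarrow>\<^bsub>G\<^esub> w}" using adj_in_verts by auto
  finally show ?thesis unfolding out_degree_eq_card_successors[OF assms(1)] .
qed

text \<open>The walk matrix is stochastic, has entries at most \<open>1 / d\<close> and is
  reversible for the degree weights, so the preceding results apply with \<open>e = 1 / d\<close>. A
  single family \<open>a\<close> describes all orders \<open>l\<close>, which lets information pass
  from one order to another.\<close>

lemma nbhd_laplacian_spectrum:
  assumes G: "conn_graph_min_degree G vs d"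
  obtains a where "\<And>l x. eigenvalue (nbhd_laplacian G vs l) x \<longleftrightarrow> (\<exists>i<length vs. x = 1 - a i ^ l)"
    and "\<And>i. i < length vs \<Longrightarrow> eigenvalue (walk_mat G vs) (a i)"
    and "\<exists>i<length vs. (a i)\<^sup>2 \<le> (real d - 1) / (real d)\<^sup>2"
proof -
  have gr: "graph G" and ve: "vertex_enum G vs" and d: "3 \<le> d" and md: "min_degree G = d"
    and c: "3 \<le> card (verts G)"
    using G by (auto simp: conn_graph_min_degree_def)
  interpret graph G by fact
  define n where "n = length vs"
  have vs: "distinct vs" "set vs = verts G" using ve by (auto simp: vertex_enum_def)
  have "n > 0" using c vs distinct_card[OF vs(1)] by (auto simp: n_def)
  have deg: "out_degree G (vs ! i) \<ge> d" if "i < n" for i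
    unfolding md[symmetric] min_degree_def
    using that vs(2) nth_mem[of i vs] by (intro Min_le) (auto simp: n_def)
  let ?W = "walk_mat G vs"
  note W = walk_mat_carrier[of G vs, folded n_def]
  note idx = walk_mat_index[of _ vs _ G, folded n_def]
  define e where "e = 1 / real d"
  have e: "0 < e" "e \<le> 1 / 3" using d by (auto simp: e_def field_simps)
  have nonneg: "?W $$ (i, j) \<ge> 0" if "i < n" "j < n" for i j
    using that by (simp add: idx)
  have entry: "?W $$ (i, j) \<le> e" if "i < n" "j < n" for i j
    using deg[OF that(1)] d e that by (auto simp: idx e_def intro!: divide_left_mono)
  have row: "(\<Sum>j<n. ?W $$ (i, j)) = 1" if "i < n" for i
  proof -
    have "(\<Sum>j<n. ?W $$ (i, j)) =
        (\<Sum>j<n. (if vs ! i \<rightarrow>\<^bsub>G\<^esub> vs ! j then 1 else 0) / real (out_degree G (vs ! i)))"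
      by (intro sum.cong) (use that in \<open>auto simp: idx\<close>)
    also have "\<dots> = real (out_degree G (vs ! i)) / real (out_degree G (vs ! i))"
      unfolding sum_divide_distrib[symmetric] n_def sum_adjacency_row[OF gr ve] ..
    finally show ?thesis using deg[OF that] d by simp
  qed
  have real: "z \<in> \<real>" if "eigenvalue (map_mat complex_of_real ?W) z" for z
  proof (rule reversible_eigenvalue_real[OF W _ _ that])
    show "0 < real (out_degree G (vs ! i))" if "i < n" for i using deg[OF that] d by simp
    \<comment> \<open>Both sides are entries of the adjacency matrix, which is symmetric.\<close>
    show "real (out_degree G (vs ! i)) * ?W $$ (i, j) = real (out_degree G (vs ! j)) * ?W $$ (j, i)"
      if "i < n" "j < n" for i j
      using deg[of i] deg[of j] d that arcs_ends_symmetric[OF sym_arcs] by (auto simp: idx)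
  qed
  obtain a where a: "\<And>k x. eigenvalue (?W ^\<^sub>m k) x \<longleftrightarrow> (\<exists>i<n. x = a i ^ k)"
    using real_power_spectrum[OF W real] by metis
  have a1: "eigenvalue ?W x \<longleftrightarrow> (\<exists>i<n. x = a i)" for x
    using a[of 1 x] W by simp
  obtain x where x: "eigenvalue ?W x" "x\<^sup>2 \<le> e - e\<^sup>2"
    by (rule stochastic_small_eigenvalue[OF W \<open>n > 0\<close> nonneg row entry e real])
  have c: "e - e\<^sup>2 = (real d - 1) / (real d)\<^sup>2"
    using d by (simp add: e_def field_simps power2_eq_square)
  show thesis
  proof
    fix l x
    have "?W ^\<^sub>m l \<in> carrier_mat n n" using W by simp
    from eigenvalue_one_minus[OF this]
    have "eigenvalue (nbhd_laplacian G vs l) x \<longleftrightarrow> eigenvalue (?W ^\<^sub>m l) (1 - x)"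
      by (simp add: nbhd_laplacian_eq n_def)
    also have "\<dots> \<longleftrightarrow> (\<exists>i<n. 1 - x = a i ^ l)" by (rule a)
    also have "\<dots> \<longleftrightarrow> (\<exists>i<n. x = 1 - a i ^ l)"
      by (intro ex_cong1 conj_cong refl) linarith
    finally show "eigenvalue (nbhd_laplacian G vs l) x \<longleftrightarrow> (\<exists>i<length vs. x = 1 - a i ^ l)"
      by (simp add: n_def)
  next
    show "eigenvalue ?W (a i)" if "i < length vs" for i using a1 that by (auto simp: n_def)
    show "\<exists>i<length vs. (a i)\<^sup>2 \<le> (real d - 1) / (real d)\<^sup>2"
      using x a1 by (auto simp: n_def c)
  qed
qed

section \<open>Bounds for the largest eigenvalue and criteria for equality\<close>

lemma nbhd_laplacian_carrier: "nbhd_laplacian G vs l \<in> carrier_mat (length vs) (length vs)"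
  using walk_mat_carrier[of G vs] by (auto simp: nbhd_laplacian_eq)

lemma nbhd_laplacian_eigenvalue_near_1:
  assumes "conn_graph_min_degree G vs d"
  shows "\<exists>x. eigenvalue (nbhd_laplacian G vs l) x \<and> \<bar>1 - x\<bar> \<le> (sqrt (real d - 1) / real d) ^ l"
proof -
  obtain a where a: "\<And>l x. eigenvalue (nbhd_laplacian G vs l) x \<longleftrightarrow> (\<exists>i<length vs. x = 1 - a i ^ l)"
    and ex: "\<exists>i<length vs. (a i)\<^sup>2 \<le> (real d - 1) / (real d)\<^sup>2"
    using nbhd_laplacian_spectrum[OF assms] by metis
  from ex obtain i where i: "i < length vs" "(a i)\<^sup>2 \<le> (real d - 1) / (real d)\<^sup>2" by auto
  have "\<bar>a i\<bar> = sqrt ((a i)\<^sup>2)" by simp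
  also have "\<dots> \<le> sqrt ((real d - 1) / (real d)\<^sup>2)" using i(2) by (rule real_sqrt_le_mono)
  also have "\<dots> = sqrt (real d - 1) / real d" by (simp add: real_sqrt_divide)
  finally have "\<bar>a i\<bar> ^ l \<le> (sqrt (real d - 1) / real d) ^ l" by (intro power_mono) auto
  then show ?thesis using i(1) a by (intro exI[of _ "1 - a i ^ l"]) (auto simp: power_abs)
qed

text \<open>Even powers are nonnegative, so no \<open>1 - a i ^ (2 * k)\<close> exceeds 1; the index
  with small \<open>a i\<close> supplies the lower bound.\<close>

lemma nbhd_laplacian_even_largest_eigenvalue_bounds:
  assumes "conn_graph_min_degree G vs d"
  shows "1 - (real d - 1) ^ k / real d ^ (2 * k) \<le> largest_eigenvalue (nbhd_laplacian G vs (2 * k))"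
    and "largest_eigenvalue (nbhd_laplacian G vs (2 * k)) \<le> 1"
proof -
  let ?N = "nbhd_laplacian G vs (2 * k)"
  obtain a where a: "\<And>l x. eigenvalue (nbhd_laplacian G vs l) x \<longleftrightarrow> (\<exists>i<length vs. x = 1 - a i ^ l)"
    and ex: "\<exists>i<length vs. (a i)\<^sup>2 \<le> (real d - 1) / (real d)\<^sup>2"
    using nbhd_laplacian_spectrum[OF assms] by metis
  from ex obtain i where i: "i < length vs" "(a i)\<^sup>2 \<le> (real d - 1) / (real d)\<^sup>2" by auto
  have fin: "finite (spectrum ?N)" using card_finite_spectrum(1)[OF nbhd_laplacian_carrier] .
  have mem: "1 - a i ^ (2 * k) \<in> spectrum ?N" using a i by (auto simp: spectrum_def)
  have "a i ^ (2 * k) \<le> ((real d - 1) / (real d)\<^sup>2) ^ k"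
    unfolding power_mult using i by (intro power_mono) auto
  also have "\<dots> = (real d - 1) ^ k / real d ^ (2 * k)" by (simp add: power_divide power_mult)
  finally show "1 - (real d - 1) ^ k / real d ^ (2 * k) \<le> largest_eigenvalue ?N"
    using Max_ge[OF fin mem] unfolding largest_eigenvalue_def by linarith
  show "largest_eigenvalue ?N \<le> 1"
    unfolding largest_eigenvalue_def using fin mem
    by (subst Max_le_iff) (auto simp: spectrum_def a power_mult)
qed

text \<open>Reduces sharpness of the lower bound to a spectral gap around 0: if no eigenvalue of the
  walk lies strictly inside the guaranteed radius, every \<open>1 - a i ^ (2 * k)\<close> is at most
  the lower bound.\<close>

lemma largest_eigenvalue_minimalI:
  assumes G: "conn_graph_min_degree G vs d"
    and gap: "\<And>x. eigenvalue (walk_mat G vs) x \<Longrightarrow> (real d - 1) / (real d)\<^sup>2 \<le> x\<^sup>2"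
  shows "largest_eigenvalue (nbhd_laplacian G vs (2 * k)) = 1 - (real d - 1) ^ k / real d ^ (2 * k)"
proof (rule antisym)
  let ?N = "nbhd_laplacian G vs (2 * k)"
  have d: "3 \<le> d" using G by (simp add: conn_graph_min_degree_def)
  obtain a where a: "\<And>l x. eigenvalue (nbhd_laplacian G vs l) x \<longleftrightarrow> (\<exists>i<length vs. x = 1 - a i ^ l)"
    and ev: "\<And>i. i < length vs \<Longrightarrow> eigenvalue (walk_mat G vs) (a i)"
    and ex: "\<exists>i<length vs. (a i)\<^sup>2 \<le> (real d - 1) / (real d)\<^sup>2"
    using nbhd_laplacian_spectrum[OF G] by metis
  have fin: "finite (spectrum ?N)" using card_finite_spectrum(1)[OF nbhd_laplacian_carrier] .
  have "spectrum ?N \<noteq> {}" using ex a by (auto simp: spectrum_def)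
  then have "largest_eigenvalue ?N \<in> spectrum ?N"
    unfolding largest_eigenvalue_def using fin by (rule Max_in[rotated])
  then obtain i where i: "i < length vs" "largest_eigenvalue ?N = 1 - a i ^ (2 * k)"
    by (auto simp: spectrum_def a)
  have "(real d - 1) ^ k / real d ^ (2 * k) = ((real d - 1) / (real d)\<^sup>2) ^ k"
    by (simp add: power_divide power_mult)
  also have "\<dots> \<le> a i ^ (2 * k)"
    unfolding power_mult using gap[OF ev[OF i(1)]] d by (intro power_mono) auto
  finally show "largest_eigenvalue ?N \<le> 1 - (real d - 1) ^ k / real d ^ (2 * k)"
    using i by simp
qed (rule nbhd_laplacian_even_largest_eigenvalue_bounds(1)[OF G])

lemma largest_eigenvalue_eq_1I:
  assumes G: "conn_graph_min_degree G vs d" and ev: "eigenvalue (walk_mat G vs) 0" and "k \<ge> 1"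
  shows "largest_eigenvalue (nbhd_laplacian G vs (2 * k)) = 1"
proof (rule antisym)
  let ?N = "nbhd_laplacian G vs (2 * k)"
  obtain a where a: "\<And>l x. eigenvalue (nbhd_laplacian G vs l) x \<longleftrightarrow> (\<exists>i<length vs. x = 1 - a i ^ l)"
    using nbhd_laplacian_spectrum[OF G] by metis
  \<comment> \<open>Order 1 serves to find an index with \<open>a i = 0\<close>; the same index then
    yields the eigenvalue 1 for order \<open>2 * k\<close>, where \<open>k \<ge> 1\<close> makes the
    power of 0 vanish.\<close>
  have "eigenvalue (nbhd_laplacian G vs 1) 1"
    using ev eigenvalue_one_minus[OF walk_mat_carrier[of G vs], of 1] walk_mat_carrier[of G vs]
    by (simp add: nbhd_laplacian_eq)
  then obtain i where "i < length vs" "a i = 0" unfolding a by auto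
  then have "eigenvalue ?N 1" unfolding a using \<open>k \<ge> 1\<close> by (auto intro!: exI[of _ i])
  then show "1 \<le> largest_eigenvalue ?N"
    unfolding largest_eigenvalue_def
    using card_finite_spectrum(1)[OF nbhd_laplacian_carrier] by (intro Max_ge) (auto simp: spectrum_def)
qed (rule nbhd_laplacian_even_largest_eigenvalue_bounds(2)[OF G])

section \<open>Graphs given by a relation on an initial segment of the naturals\<close>

text \<open>An arc is the pair of its ends, which rules out parallel arcs, and the vertex set is
  enumerated by \<open>[0..<n]\<close>.\<close>

definition relation_graph :: "nat \<Rightarrow> (nat \<Rightarrow> nat \<Rightarrow> bool) \<Rightarrow> (nat, nat \<times> nat) pre_digraph" where
  "relation_graph n R =
    \<lparr>verts = {..<n}, arcs = {(i, j). i < n \<and> j < n \<and> R i j}, tail = fst, head = snd\<rparr>"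

lemma arcs_ends_relation_graph:
  "arcs_ends (relation_graph n R) = {(i, j). i < n \<and> j < n \<and> R i j}"
  by (auto simp: arcs_ends_def arc_to_ends_def relation_graph_def)

lemma graph_relation_graph:
  assumes "\<And>i j. i < n \<Longrightarrow> j < n \<Longrightarrow> R i j \<Longrightarrow> R j i" "\<And>i. i < n \<Longrightarrow> \<not> R i i"
  shows "graph (relation_graph n R)"
proof
  let ?G = "relation_graph n R"
  show "finite (arcs ?G)"
    by (rule finite_subset[of _ "{..<n} \<times> {..<n}"]) (auto simp: relation_graph_def)
  show "symmetric ?G"
    using assms(1) by (auto simp: symmetric_def arcs_ends_relation_graph sym_def)
qed (use assms(2) in \<open>auto simp: relation_graph_def arc_to_ends_def\<close>)

lemma connected_relation_graph:
  assumes "n > 0" and reach: "\<And>i j. i < n \<Longrightarrow> j < n \<Longrightarrow> (i, j) \<in> {(i, j). i < n \<and> j < n \<and> R i j}\<^sup>*"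
  shows "Digraph_Component.connected (relation_graph n R)"
proof -
  let ?G = "relation_graph n R"
  have v: "verts ?G = {..<n}" by (simp add: relation_graph_def)
  interpret wf_digraph ?G by unfold_locales (auto simp: relation_graph_def)
  have "i \<rightarrow>\<^sup>*\<^bsub>?G\<^esub> j" if "i < n" "j < n" for i j
    using reach[OF that] that unfolding arcs_ends_relation_graph[symmetric]
    by (simp add: reachable_conv v)
  then have "strongly_connected ?G"
    using assms(1) by (auto simp: strongly_connected_def v)
  then show ?thesis
    by (auto simp: Digraph_Component.connected_def strongly_connected_def intro: reachable_mk_symmetricI)
qed

section \<open>Extremal graphs\<close>

lemma rtrancl_image:
  assumes "(x, y) \<in> A\<^sup>*" "\<And>x y. (x, y) \<in> A \<Longrightarrow> (g x, g y) \<in> B"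
  shows "(g x, g y) \<in> B\<^sup>*"
  using assms(1) by induction (auto intro: assms(2) rtrancl.rtrancl_into_rtrancl)

section \<open>Realizing regular relations and their bipartite doubles as graphs\<close>

text \<open>Transport along a bijection \<open>h\<close> from \<open>{..<n}\<close> to
  \<open>V\<close> lets the examples be built on any convenient set. By regularity the walk matrix
  is the adjacency matrix divided by \<open>d\<close>, so its eigenvectors become functions on
  \<open>V\<close> and no matrix remains.\<close>

lemma regular_relation_realization:
  fixes E :: "'a \<Rightarrow> 'a \<Rightarrow> bool"
  assumes V: "finite V" "3 \<le> card V" and d: "3 \<le> d"
    and sym: "\<And>u v. u \<in> V \<Longrightarrow> v \<in> V \<Longrightarrow> E u v \<Longrightarrow> E v u"
    and irrefl: "\<And>v. v \<in> V \<Longrightarrow> \<not> E v v"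
    and reg: "\<And>v. v \<in> V \<Longrightarrow> card {w \<in> V. E v w} = d"
    and reach: "\<And>u v. u \<in> V \<Longrightarrow> v \<in> V \<Longrightarrow> (u, v) \<in> {(u, v). u \<in> V \<and> v \<in> V \<and> E u v}\<^sup>*"
  obtains G :: "(nat, nat \<times> nat) pre_digraph" and vs where
    "conn_graph_min_degree G vs d"
    "\<And>x. eigenvalue (walk_mat G vs) x \<longleftrightarrow>
      (\<exists>f. (\<exists>v\<in>V. f v \<noteq> 0) \<and> (\<forall>v\<in>V. (\<Sum>w\<in>V. of_bool (E v w) * f w) = real d * x * f v))"
proof -
  define n where "n = card V"
  obtain h where h: "bij_betw h {..<n} V"
    using ex_bij_betw_nat_finite[OF V(1)] by (auto simp: n_def lessThan_atLeast0)
  have hV: "h i \<in> V" if "i < n" for i using h that by (auto simp: bij_betw_def)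
  define g where "g = inv_into {..<n} h"
  have gh: "g (h i) = i" if "i < n" for i
    using h that by (auto simp: g_def bij_betw_def inv_into_f_f)
  have g: "g v < n" "h (g v) = v" if "v \<in> V" for v
    using h that by (auto simp: g_def bij_betw_def f_inv_into_f dest: inv_into_into[of v h "{..<n}"])
  define R where "R = (\<lambda>i j. E (h i) (h j))"
  define G where "G = relation_graph n R"
  define vs where "vs = [0..<n]"
  have n: "n > 0" using V(2) unfolding n_def by linarith
  have ends: "arcs_ends G = {(i, j). i < n \<and> j < n \<and> R i j}"
    by (simp add: G_def arcs_ends_relation_graph)
  have gr: "graph G"
    unfolding G_def using sym irrefl hV by (intro graph_relation_graph) (auto simp: R_def)
  have deg: "out_degree G i = d" if "i < n" for i
  proof -
    have "bij_betw h {j. i \<rightarrow>\<^bsub>G\<^esub> j} {w \<in> V. E (h i) w}"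
      using h that unfolding ends by (auto simp: bij_betw_def R_def inj_on_def)
    then show ?thesis
      using reg[OF hV[OF that]] out_degree_eq_card_successors[OF gr] bij_betw_same_card by metis
  qed
  have "Digraph_Component.connected G"
    unfolding G_def
  proof (rule connected_relation_graph[OF n])
    fix i j assume ij: "i < n" "j < n"
    have "(g (h i), g (h j)) \<in> {(i, j). i < n \<and> j < n \<and> R i j}\<^sup>*"
      by (rule rtrancl_image[OF reach[OF hV[OF ij(1)] hV[OF ij(2)]]]) (use g in \<open>auto simp: R_def\<close>)
    then show "(i, j) \<in> {(i, j). i < n \<and> j < n \<and> R i j}\<^sup>*" using gh ij by simp
  qed
  moreover have "out_degree G ` verts G = {d}"
    using deg n by (auto simp: G_def relation_graph_def)
  ultimately have cg: "conn_graph_min_degree G vs d"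
    using gr V d by (auto simp: conn_graph_min_degree_def vertex_enum_def min_degree_def vs_def
      G_def relation_graph_def n_def)
  have W: "walk_mat G vs \<in> carrier_mat n n" using walk_mat_carrier[of G vs] by (simp add: vs_def)
  \<comment> \<open>Reindexing along \<open>h\<close> turns the matrix product into a sum over
    \<open>V\<close>, with the common degree as denominator.\<close>
  have row: "(walk_mat G vs *\<^sub>v v) $ i = (\<Sum>w\<in>V. of_bool (E (h i) w) * v $ g w) / d"
    if "i < n" "v \<in> carrier_vec n" for i v
  proof -
    have "(walk_mat G vs *\<^sub>v v) $ i = (\<Sum>j<n. of_bool (E (h i) (h j)) * v $ g (h j) / d)"
      unfolding index_mult_mat_vec_sum[OF W that(2,1)]
      using that by (intro sum.cong) (auto simp: walk_mat_index vs_def ends deg R_def gh)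
    also have "\<dots> = (\<Sum>w\<in>V. of_bool (E (h i) w) * v $ g w / d)"
      using h by (rule sum.reindex_bij_betw)
    finally show ?thesis by (simp add: sum_divide_distrib)
  qed
  have "eigenvalue (walk_mat G vs) x \<longleftrightarrow>
      (\<exists>f. (\<exists>v\<in>V. f v \<noteq> 0) \<and> (\<forall>v\<in>V. (\<Sum>w\<in>V. of_bool (E v w) * f w) = real d * x * f v))" for x
  proof
    assume "eigenvalue (walk_mat G vs) x"
    then obtain v where v: "v \<in> carrier_vec n" "v \<noteq> 0\<^sub>v n" "walk_mat G vs *\<^sub>v v = x \<cdot>\<^sub>v v"
      using W by (auto simp: eigenvalue_def eigenvector_def)
    obtain i where i: "i < n" "v $ i \<noteq> 0"
      using v(1,2) by (metis carrier_vecD eq_vecI index_zero_vec(1,2))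
    have "(\<Sum>w\<in>V. of_bool (E u w) * v $ g w) = real d * x * v $ g u" if "u \<in> V" for u
      using row[OF g(1)[OF that] v(1)] v d g[OF that] by (simp add: field_simps)
    moreover have "\<exists>u\<in>V. v $ g u \<noteq> 0" using i gh hV by (intro bexI[of _ "h i"]) auto
    ultimately show "\<exists>f. (\<exists>v\<in>V. f v \<noteq> 0) \<and> (\<forall>v\<in>V. (\<Sum>w\<in>V. of_bool (E v w) * f w) = real d * x * f v)"
      by (intro exI[of _ "\<lambda>u. v $ g u"]) auto
  next
    assume "\<exists>f. (\<exists>v\<in>V. f v \<noteq> 0) \<and> (\<forall>v\<in>V. (\<Sum>w\<in>V. of_bool (E v w) * f w) = real d * x * f v)"
    then obtain f u where u: "u \<in> V" "f u \<noteq> 0"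
      and f: "\<And>v. v \<in> V \<Longrightarrow> (\<Sum>w\<in>V. of_bool (E v w) * f w) = real d * x * f v" by auto
    define v where "v = vec n (\<lambda>i. f (h i))"
    have v: "v \<in> carrier_vec n" by (simp add: v_def)
    have vg: "v $ g w = f w" if "w \<in> V" for w using g that by (simp add: v_def)
    have "v \<noteq> 0\<^sub>v n" using u vg[of u] g[of u] by auto
    moreover have "walk_mat G vs *\<^sub>v v = x \<cdot>\<^sub>v v"
    proof (rule eq_vecI)
      fix i assume "i < dim_vec (x \<cdot>\<^sub>v v)"
      then have i: "i < n" by (simp add: v_def)
      have "(\<Sum>w\<in>V. of_bool (E (h i) w) * v $ g w) = (\<Sum>w\<in>V. of_bool (E (h i) w) * f w)"
        using vg by (intro sum.cong) auto
      then show "(walk_mat G vs *\<^sub>v v) $ i = (x \<cdot>\<^sub>v v) $ i"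
        using row[OF i v] f[OF hV[OF i]] i d by (simp add: v_def)
    qed (use W in \<open>auto simp: v_def\<close>)
    ultimately show "eigenvalue (walk_mat G vs) x"
      using W v by (auto simp: eigenvalue_def eigenvector_def)
  qed
  then show thesis using that cg by blast
qed

text \<open>Each point of \<open>X\<close> gets two copies, tagged by a Boolean, and edges always
  flip the tag. So \<open>r\<close> may relate a point to itself without creating a loop. The
  functions \<open>f\<close> and \<open>g\<close> are the restrictions of an eigenfunction to the
  two copies.\<close>

lemma bipartite_double_realization:
  fixes r :: "'a \<Rightarrow> 'a \<Rightarrow> bool"
  assumes X: "finite X" "X \<noteq> {}" and d: "3 \<le> d"
    and sym: "\<And>x y. r x y \<Longrightarrow> r y x"
    and reg: "\<And>x. x \<in> X \<Longrightarrow> card {y \<in> X. r x y} = d"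
    and common: "\<And>x y. x \<in> X \<Longrightarrow> y \<in> X \<Longrightarrow> \<exists>z\<in>X. r x z \<and> r y z"
  obtains G :: "(nat, nat \<times> nat) pre_digraph" and vs where
    "conn_graph_min_degree G vs d"
    "\<And>t. eigenvalue (walk_mat G vs) t \<longleftrightarrow>
      (\<exists>f g. (\<exists>x\<in>X. f x \<noteq> 0 \<or> g x \<noteq> 0) \<and>
        (\<forall>x\<in>X. (\<Sum>y\<in>X. of_bool (r x y) * g y) = real d * t * f x \<and>
               (\<Sum>y\<in>X. of_bool (r x y) * f y) = real d * t * g x))"
proof -
  define V where "V = X \<times> (UNIV :: bool set)"
  define E where "E = (\<lambda>(u :: 'a \<times> bool) v. snd u \<noteq> snd v \<and> r (fst u) (fst v))"
  define S where "S = {(u, v). u \<in> V \<and> v \<in> V \<and> E u v}"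
  have finV: "finite V" using X by (simp add: V_def)
  obtain x0 where x0: "x0 \<in> X" using X by auto
  have "d \<le> card X" using reg[OF x0] card_mono[OF X(1), of "{y \<in> X. r x0 y}"] by auto
  then have cV: "3 \<le> card V" using d by (simp add: V_def card_cartesian_product)
  have regV: "card {w \<in> V. E v w} = d" if "v \<in> V" for v
  proof -
    have v: "fst v \<in> X" using that by (auto simp: V_def)
    have "{w \<in> V. E v w} = {y \<in> X. r (fst v) y} \<times> {\<not> snd v}"
      by (auto simp: V_def E_def)
    then have "card {w \<in> V. E v w} = card {y \<in> X. r (fst v) y}"
      by (simp only: card_cartesian_product) simp
    then show ?thesis using reg[OF v] by simp
  qed
  have step: "((x, a), (y, \<not> a)) \<in> S" if "x \<in> X" "y \<in> X" "r x y" for x y a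
    using that by (auto simp: S_def V_def E_def)
  \<comment> \<open>A common neighbour, visited in the other copy, joins two points of one copy in
    two steps.\<close>
  have same: "((x, a), (y, a)) \<in> S\<^sup>*" if xy: "x \<in> X" "y \<in> X" for x y a
  proof -
    obtain z where z: "z \<in> X" "r x z" "r y z" using common[OF xy] by auto
    have "((x, a), (z, \<not> a)) \<in> S" "((z, \<not> a), (y, a)) \<in> S"
      using step[of x z a] step[of z y "\<not> a"] z xy sym by auto
    then show ?thesis by auto
  qed
  have "((x, a), (y, b)) \<in> S\<^sup>*" if xy: "x \<in> X" "y \<in> X" for x y a b
  proof (cases "a = b")
    case True then show ?thesis using same xy by simp
  next
    case False
    \<comment> \<open>Taking both arguments of \<open>common\<close> to be \<open>y\<close> gives
      some neighbour of \<open>y\<close>, from which a last step changes the copy.\<close>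
    obtain z where z: "z \<in> X" "r y z" using common[OF xy(2) xy(2)] by auto
    have "((z, a), (y, b)) \<in> S" using step[of z y a] z xy sym False by (cases a; cases b) auto
    then show ?thesis using same[OF xy(1) z(1), of a] by (rule rtrancl.rtrancl_into_rtrancl[rotated])
  qed
  then have reach: "(u, v) \<in> {(u, v). u \<in> V \<and> v \<in> V \<and> E u v}\<^sup>*" if "u \<in> V" "v \<in> V" for u v
    using that unfolding S_def[symmetric] by (cases u; cases v) (auto simp: V_def)
  obtain G :: "(nat, nat \<times> nat) pre_digraph" and vs where
    G: "conn_graph_min_degree G vs d" and
    ev: "\<And>t. eigenvalue (walk_mat G vs) t \<longleftrightarrow>
      (\<exists>f. (\<exists>v\<in>V. f v \<noteq> 0) \<and> (\<forall>v\<in>V. (\<Sum>w\<in>V. of_bool (E v w) * f w) = real d * t * f v))"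
    by (rule regular_relation_realization[of V d E])
       (use finV cV d regV reach sym in \<open>auto simp: E_def\<close>)
  have sumV: "(\<Sum>w\<in>V. of_bool (E (x, a) w) * F w) = (\<Sum>y\<in>X. of_bool (r x y) * F (y, \<not> a))"
    for x a and F :: "_ \<Rightarrow> real"
  proof -
    have "(\<Sum>w\<in>V. of_bool (E (x, a) w) * F w) =
        (\<Sum>y\<in>X. \<Sum>b\<in>UNIV. of_bool (E (x, a) (y, b)) * F (y, b))"
      unfolding V_def by (subst sum.cartesian_product) simp
    also have "\<dots> = (\<Sum>y\<in>X. of_bool (r x y) * F (y, \<not> a))"
      by (intro sum.cong refl) (cases a; simp add: E_def UNIV_bool)
    finally show ?thesis .
  qed
  have "eigenvalue (walk_mat G vs) t \<longleftrightarrow>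
      (\<exists>f g. (\<exists>x\<in>X. f x \<noteq> 0 \<or> g x \<noteq> 0) \<and>
        (\<forall>x\<in>X. (\<Sum>y\<in>X. of_bool (r x y) * g y) = real d * t * f x \<and>
               (\<Sum>y\<in>X. of_bool (r x y) * f y) = real d * t * g x))" (is "_ \<longleftrightarrow> ?rhs") for t
  proof
    assume "eigenvalue (walk_mat G vs) t"
    then obtain F where F: "\<exists>v\<in>V. F v \<noteq> 0"
      "\<And>v. v \<in> V \<Longrightarrow> (\<Sum>w\<in>V. of_bool (E v w) * F w) = real d * t * F v" unfolding ev by auto
    have "\<exists>x\<in>X. F (x, False) \<noteq> 0 \<or> F (x, True) \<noteq> 0"
      using F(1) by (auto simp: V_def) (metis (full_types))
    moreover have "(\<Sum>y\<in>X. of_bool (r x y) * F (y, \<not> a)) = real d * t * F (x, a)" if "x \<in> X" for x a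
      using F(2)[of "(x, a)"] that unfolding sumV by (auto simp: V_def)
    from this[of _ False] this[of _ True]
    have "\<forall>x\<in>X. (\<Sum>y\<in>X. of_bool (r x y) * F (y, True)) = real d * t * F (x, False) \<and>
        (\<Sum>y\<in>X. of_bool (r x y) * F (y, False)) = real d * t * F (x, True)" by simp
    ultimately show ?rhs
      by (intro exI[of _ "\<lambda>x. F (x, False)"] exI[of _ "\<lambda>x. F (x, True)"]) auto
  next
    assume ?rhs
    then obtain f g where fg: "\<exists>x\<in>X. f x \<noteq> 0 \<or> g x \<noteq> 0"
      "\<And>x. x \<in> X \<Longrightarrow> (\<Sum>y\<in>X. of_bool (r x y) * g y) = real d * t * f x \<and>
               (\<Sum>y\<in>X. of_bool (r x y) * f y) = real d * t * g x" by auto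
    define F where "F = (\<lambda>(x, a). if a then g x else f x)"
    have "\<exists>v\<in>V. F v \<noteq> 0"
      using fg(1) by (auto simp: V_def F_def intro: bexI[of _ "(_, True)"] bexI[of _ "(_, False)"])
    moreover have "(\<Sum>w\<in>V. of_bool (E v w) * F w) = real d * t * F v" if "v \<in> V" for v
    proof -
      obtain x a where v: "v = (x, a)" by (cases v)
      then have "x \<in> X" using that by (simp add: V_def)
      then show ?thesis unfolding v sumV using fg(2)[of x] by (cases a) (simp_all add: F_def)
    qed
    ultimately show "eigenvalue (walk_mat G vs) t" unfolding ev by blast
  qed
  then show thesis using that G by blast
qed

section \<open>Sharpness of the upper bound: complete bipartite graphs\<close>

lemma complete_bipartite_sharp:
  assumes "d \<ge> 3" "k \<ge> 1"
  shows "\<exists>(G :: (nat, nat \<times> nat) pre_digraph) vs. conn_graph_min_degree G vs d \<and>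
    largest_eigenvalue (nbhd_laplacian G vs (2 * k)) = 1"
proof -
  obtain G :: "(nat, nat \<times> nat) pre_digraph" and vs where G: "conn_graph_min_degree G vs d"
    and ev: "\<And>t. eigenvalue (walk_mat G vs) t \<longleftrightarrow>
      (\<exists>f g. (\<exists>x\<in>{..<d}. f x \<noteq> 0 \<or> g x \<noteq> 0) \<and>
        (\<forall>x\<in>{..<d}. (\<Sum>y\<in>{..<d}. of_bool True * g y) = real d * t * f x \<and>
               (\<Sum>y\<in>{..<d}. of_bool True * f y) = real d * t * g x))"
    by (rule bipartite_double_realization[of "{..<d}" d "\<lambda>_ _. True"]) (use assms in \<open>auto simp: lessThan_empty_iff\<close>)
  \<comment> \<open>A function with zero sum on one side and 0 on the other is annihilated by the
    adjacency matrix.\<close>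
  define f where "f = (\<lambda>i::nat. of_bool (i = 0) - of_bool (i = 1) :: real)"
  have "(\<Sum>y<d. f y) = 0" using assms by (simp add: f_def sum_subtractf of_bool_def)
  moreover have "f 0 \<noteq> 0" by (simp add: f_def)
  ultimately have "eigenvalue (walk_mat G vs) 0"
    unfolding ev using assms by (intro exI[of _ f] exI[of _ "\<lambda>_. 0"]) (auto intro!: bexI[of _ 0])
  then show ?thesis using largest_eigenvalue_eq_1I[OF G] G assms by blast
qed

section \<open>Sharpness of the lower bound: incidence relations with a polarity\<close>

text \<open>With \<open>N\<close> the matrix of \<open>r\<close>, \<open>I\<close> the identity and
  \<open>J\<close> the all-ones matrix, the counts say \<open>N^2 = (d - 1) I + J\<close>. An
  eigenvalue \<open>t\<close> therefore has \<open>(d t)^2 = d - 1\<close>, or else its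
  eigenfunction is constant on each copy and \<open>t^2 = 1\<close>.\<close>

lemma polarity_sharp:
  fixes r :: "'a \<Rightarrow> 'a \<Rightarrow> bool"
  assumes X: "finite X" "X \<noteq> {}" and d: "3 \<le> d"
    and sym: "\<And>x y. r x y \<Longrightarrow> r y x"
    and reg: "\<And>x. x \<in> X \<Longrightarrow> card {y \<in> X. r x y} = d"
    and common: "\<And>x y. x \<in> X \<Longrightarrow> y \<in> X \<Longrightarrow> x \<noteq> y \<Longrightarrow> card {z \<in> X. r x z \<and> r y z} = 1"
  shows "\<exists>(G :: (nat, nat \<times> nat) pre_digraph) vs. conn_graph_min_degree G vs d \<and>
    largest_eigenvalue (nbhd_laplacian G vs (2 * k)) = 1 - (real d - 1) ^ k / real d ^ (2 * k)"
proof -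
  have card_eq: "card {z \<in> X. r x z \<and> r y z} = (if x = y then d else 1)"
    if "x \<in> X" "y \<in> X" for x y using reg common that by auto
  have ex: "\<exists>z\<in>X. r x z \<and> r y z" if "x \<in> X" "y \<in> X" for x y
  proof -
    have "card {z \<in> X. r x z \<and> r y z} \<noteq> 0" using card_eq[OF that] d by auto
    then have "{z \<in> X. r x z \<and> r y z} \<noteq> {}" by (metis card.empty)
    then show ?thesis by blast
  qed
  obtain G :: "(nat, nat \<times> nat) pre_digraph" and vs where G: "conn_graph_min_degree G vs d"
    and ev: "\<And>t. eigenvalue (walk_mat G vs) t \<longleftrightarrow>
      (\<exists>f g. (\<exists>x\<in>X. f x \<noteq> 0 \<or> g x \<noteq> 0) \<and>
        (\<forall>x\<in>X. (\<Sum>y\<in>X. of_bool (r x y) * g y) = real d * t * f x \<and>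
               (\<Sum>y\<in>X. of_bool (r x y) * f y) = real d * t * g x))"
    using bipartite_double_realization[of X d r, OF X d sym reg ex] by blast
  \<comment> \<open>Applying the relation twice counts common neighbours: \<open>d\<close> for a
    point with itself and 1 for two distinct points. Stated for arbitrary \<open>f\<close> and
    \<open>g\<close>, it is used again with their roles exchanged.\<close>
  have two_step: "(real d * t)\<^sup>2 * f x = (real d - 1) * f x + (\<Sum>y\<in>X. f y)"
    if "x \<in> X"
      and fg: "\<And>x. x \<in> X \<Longrightarrow> (\<Sum>y\<in>X. of_bool (r x y) * g y) = real d * t * f x"
      and gf: "\<And>x. x \<in> X \<Longrightarrow> (\<Sum>y\<in>X. of_bool (r x y) * f y) = real d * t * g x"
    for f g :: "'a \<Rightarrow> real" and t x
  proof -
    have "(real d * t)\<^sup>2 * f x = (\<Sum>z\<in>X. of_bool (r x z) * (real d * t * g z))"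
      using fg[OF \<open>x \<in> X\<close>] by (simp add: power2_eq_square sum_distrib_left[symmetric] mult_ac)
    also have "\<dots> = (\<Sum>z\<in>X. \<Sum>y\<in>X. of_bool (r x z) * of_bool (r z y) * f y)"
      by (intro sum.cong refl) (simp add: gf mult.assoc flip: sum_distrib_left)
    also have "\<dots> = (\<Sum>y\<in>X. (\<Sum>z\<in>X. of_bool (r x z \<and> r y z)) * f y)"
      by (subst sum.swap) (auto simp: sum_distrib_right intro!: sum.cong dest: sym)
    also have "\<dots> = (\<Sum>y\<in>X. (if y = x then real d - 1 else 0) * f y + f y)"
    proof (intro sum.cong refl)
      fix y assume "y \<in> X"
      have "(\<Sum>z\<in>X. of_bool (r x z \<and> r y z) :: real) = card {z \<in> X. r x z \<and> r y z}"
        using sum.inter_filter[OF X(1), of "\<lambda>_. 1::real" "\<lambda>z. r x z \<and> r y z"]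
        by (simp add: of_bool_def)
      also have "\<dots> = (if y = x then real d else 1)" using card_eq[OF \<open>x \<in> X\<close> \<open>y \<in> X\<close>] by auto
      finally show "(\<Sum>z\<in>X. of_bool (r x z \<and> r y z)) * f y =
          (if y = x then real d - 1 else 0) * f y + f y"
        by (auto simp: algebra_simps)
    qed
    also have "\<dots> = (real d - 1) * f x + (\<Sum>y\<in>X. f y)"
      using X(1) \<open>x \<in> X\<close> by (simp add: sum.distrib if_distrib[of "\<lambda>c. c * _"] cong: if_cong)
    finally show ?thesis .
  qed
  have "(real d - 1) / (real d)\<^sup>2 \<le> t\<^sup>2" if evt: "eigenvalue (walk_mat G vs) t" for t
  proof (cases "(real d * t)\<^sup>2 = real d - 1")
    case True
    then show ?thesis using d by (simp add: power_mult_distrib field_simps)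
  next
    case False
    from evt obtain f g where ne: "\<exists>x\<in>X. f x \<noteq> 0 \<or> g x \<noteq> 0"
      and fg: "\<And>x. x \<in> X \<Longrightarrow> (\<Sum>y\<in>X. of_bool (r x y) * g y) = real d * t * f x"
      and gf: "\<And>x. x \<in> X \<Longrightarrow> (\<Sum>y\<in>X. of_bool (r x y) * f y) = real d * t * g x"
      unfolding ev by blast
    \<comment> \<open>Away from the exceptional value, \<open>two_step\<close> can be solved for
      \<open>f x\<close>, and the solution does not depend on \<open>x\<close>.\<close>
    define \<alpha> where "\<alpha> = (\<Sum>y\<in>X. f y) / ((real d * t)\<^sup>2 - (real d - 1))"
    define \<beta> where "\<beta> = (\<Sum>y\<in>X. g y) / ((real d * t)\<^sup>2 - (real d - 1))"
    have f: "f x = \<alpha>" if "x \<in> X" for x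
      using two_step[OF that fg gf] False by (simp add: \<alpha>_def field_simps)
    have g: "g x = \<beta>" if "x \<in> X" for x
      using two_step[OF that gf fg] False by (simp add: \<beta>_def field_simps)
    obtain x where x: "x \<in> X" using X by auto
    have deg: "(\<Sum>y\<in>X. of_bool (r x y) :: real) = d"
      using reg[OF x] sum.inter_filter[OF X(1), of "\<lambda>_. 1::real" "r x"] by (simp add: of_bool_def)
    have c: "(\<Sum>y\<in>X. of_bool (r x y) * h y) = real d * b" if "\<And>y. y \<in> X \<Longrightarrow> h y = b" for h b
      unfolding deg[symmetric] sum_distrib_right by (intro sum.cong) (auto simp: that)
    have "real d * \<beta> = real d * t * \<alpha>" "real d * \<alpha> = real d * t * \<beta>"
      using fg[OF x] gf[OF x] c[OF f] c[OF g] f[OF x] g[OF x] by auto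
    then have "\<beta> = t * \<alpha>" "\<alpha> = t * \<beta>" using d by auto
    moreover have "\<alpha> \<noteq> 0 \<or> \<beta> \<noteq> 0" using ne f g by auto
    ultimately have "t\<^sup>2 = 1" by (auto simp: power2_eq_square)
    \<comment> \<open>Hence the eigenvalues with square 1 also respect the gap.\<close>
    moreover have "real d - 1 \<le> (real d)\<^sup>2" using d self_le_power[of "real d" 2] by linarith
    ultimately show ?thesis using d by (simp add: field_simps)
  qed
  then show ?thesis using largest_eigenvalue_minimalI[OF G] G by blast
qed

section \<open>Projective planes of prime order in coordinates modulo p\<close>

datatype plane_point = Affine int int | Slope int | Infinity

text \<open>
  The line with equation \<open>y = m x - b\<close> is coded by \<open>Affine m b\<close>, the vertical line \<open>x = m\<close> by \<open>Slope m\<close>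
  and the line at infinity by \<open>Infinity\<close>. With this sign of \<open>b\<close>, incidence is a symmetric relation, so the
  incidence graph of the plane is a bipartite double.
\<close>

fun incident :: "int \<Rightarrow> plane_point \<Rightarrow> plane_point \<Rightarrow> bool" where
  "incident p (Affine x y) (Affine m b) \<longleftrightarrow> [y + b = m * x] (mod p)"
| "incident p (Affine x y) (Slope m) \<longleftrightarrow> x = m"
| "incident p (Slope m) (Affine x y) \<longleftrightarrow> x = m"
| "incident p (Slope m) Infinity \<longleftrightarrow> True"
| "incident p Infinity (Slope m) \<longleftrightarrow> True"
| "incident p Infinity Infinity \<longleftrightarrow> True"
| "incident p _ _ \<longleftrightarrow> False"

text \<open>Residues modulo \<open>p\<close> are represented by \<open>{0..<p}\<close>. Read as
  points, \<open>Affine x y\<close> is an affine point, \<open>Slope m\<close> is the point at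
  infinity of the lines of slope \<open>m\<close>, and \<open>Infinity\<close> is that of the
  vertical lines.\<close>

definition plane_points :: "int \<Rightarrow> plane_point set" where
  "plane_points p = (\<lambda>(x, y). Affine x y) ` ({0..<p} \<times> {0..<p}) \<union> Slope ` {0..<p} \<union> {Infinity}"

lemma mem_plane_points [simp]:
  "Affine x y \<in> plane_points p \<longleftrightarrow> x \<in> {0..<p} \<and> y \<in> {0..<p}"
  "Slope x \<in> plane_points p \<longleftrightarrow> x \<in> {0..<p}"
  "Infinity \<in> plane_points p"
  by (auto simp: plane_points_def)

lemma finite_plane_points: "finite (plane_points p)"
  by (simp add: plane_points_def)

lemma incident_sym: "incident p u v \<Longrightarrow> incident p v u"
  by (induction p u v rule: incident.induct) (auto simp: add.commute mult.commute)

text \<open>Since \<open>b\<close> is already reduced, a point and a slope determine the intercept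
  as an actual integer and not only up to congruence.\<close>

lemma cong_affine_iff:
  fixes p :: int
  assumes "b \<in> {0..<p}"
  shows "[y + b = c] (mod p) \<longleftrightarrow> b = (c - y) mod p"
proof -
  have "[y + b = c] (mod p) \<longleftrightarrow> [b = c - y] (mod p)"
    by (simp add: cong_iff_dvd_diff algebra_simps)
  also have "\<dots> \<longleftrightarrow> b = (c - y) mod p"
    using assms by (simp add: cong_def)
  finally show ?thesis .
qed

text \<open>An affine point lies on one line of each slope and on one vertical line; the remaining
  cases read off the pencils at infinity. Written as images of \<open>{0..<p}\<close>, these sets
  are easy to count.\<close>

lemma incident_point_sets:
  assumes "p > 0"
  shows "{v \<in> plane_points p. incident p (Affine x y) v} =
      (\<lambda>m. Affine m ((m * x - y) mod p)) ` {0..<p} \<union> (if x \<in> {0..<p} then {Slope x} else {})"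
    and "{v \<in> plane_points p. incident p (Slope m) v} =
      (if m \<in> {0..<p} then Affine m ` {0..<p} else {}) \<union> {Infinity}"
    and "{v \<in> plane_points p. incident p Infinity v} = Slope ` {0..<p} \<union> {Infinity}"
proof -
  show "{v \<in> plane_points p. incident p (Affine x y) v} =
      (\<lambda>m. Affine m ((m * x - y) mod p)) ` {0..<p} \<union> (if x \<in> {0..<p} then {Slope x} else {})"
      (is "?L = ?R")
  proof (rule Set.set_eqI)
    fix v show "v \<in> ?L \<longleftrightarrow> v \<in> ?R"
      using assms by (cases v) (auto simp: cong_affine_iff image_iff)
  qed
  show "{v \<in> plane_points p. incident p (Slope m) v} =
      (if m \<in> {0..<p} then Affine m ` {0..<p} else {}) \<union> {Infinity}" (is "?L = ?R")
  proof (rule Set.set_eqI)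
    fix v show "v \<in> ?L \<longleftrightarrow> v \<in> ?R" by (cases v) auto
  qed
  show "{v \<in> plane_points p. incident p Infinity v} = Slope ` {0..<p} \<union> {Infinity}" (is "?L = ?R")
  proof (rule Set.set_eqI)
    fix v show "v \<in> ?L \<longleftrightarrow> v \<in> ?R" by (cases v) auto
  qed
qed

lemma card_incident:
  assumes "p > 0" "u \<in> plane_points (int p)"
  shows "card {v \<in> plane_points (int p). incident (int p) u v} = p + 1"
proof (cases u)
  case (Affine x y)
  have "card ((\<lambda>m. Affine m ((m * x - y) mod int p)) ` {0..<int p}) = p"
    by (subst card_image) (auto simp: inj_on_def)
  then show ?thesis
    using assms Affine by (auto simp: incident_point_sets card_Un_disjoint card_insert_if)
next
  case (Slope m)
  have "card (Affine m ` {0..<int p}) = p" by (subst card_image) (auto simp: inj_on_def)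
  then show ?thesis using assms Slope by (auto simp: incident_point_sets card_insert_if)
next
  case Infinity
  have "card (Slope ` {0..<int p}) = p" by (subst card_image) (auto simp: inj_on_def)
  then show ?thesis using assms Infinity by (auto simp: incident_point_sets card_insert_if)
qed

text \<open>This is the axiom that two distinct points span one line. Pairs involving a point at
  infinity have an evident line; for two affine points with distinct first coordinates, primality
  makes \<open>x - x'\<close> invertible.\<close>

lemma ex1_common_incident:
  assumes p: "prime (p :: int)" and uv: "u \<in> plane_points p" "v \<in> plane_points p" "u \<noteq> v"
  shows "\<exists>!w. w \<in> plane_points p \<and> incident p u w \<and> incident p v w"
proof -
  have p0: "p > 0" using p by (simp add: prime_gt_0_int)
  \<comment> \<open>With an explicit candidate \<open>w0\<close>, the easy cases become a check over
    the constructors of \<open>w\<close>.\<close>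
  have unique: "\<exists>!w. w \<in> plane_points p \<and> incident p u w \<and> incident p v w"
    if "w0 \<in> plane_points p"
      "\<And>w. w \<in> plane_points p \<Longrightarrow> incident p u w \<and> incident p v w \<longleftrightarrow> w = w0" for w0 u v
    using that by metis
  have affine_slope: "\<exists>!w. w \<in> plane_points p \<and> incident p (Affine x y) w \<and> incident p (Slope a) w"
    if "a \<in> {0..<p}" for x y a
  proof (rule unique[of "Affine a ((a * x - y) mod p)"])
    fix w assume "w \<in> plane_points p"
    then show "incident p (Affine x y) w \<and> incident p (Slope a) w \<longleftrightarrow> w = Affine a ((a * x - y) mod p)"
      by (cases w) (auto simp: cong_affine_iff)
  qed (use that p0 in auto)
  have affine_infinity: "\<exists>!w. w \<in> plane_points p \<and> incident p (Affine x y) w \<and> incident p Infinity w"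
    if "x \<in> {0..<p}" for x y
  proof (rule unique[of "Slope x"])
    fix w assume "w \<in> plane_points p"
    then show "incident p (Affine x y) w \<and> incident p Infinity w \<longleftrightarrow> w = Slope x"
      by (cases w) auto
  qed (use that in auto)
  have aff: "\<exists>!w. w \<in> plane_points p \<and> incident p (Affine x y) w \<and> incident p (Affine x' y') w"
    if x: "x \<in> {0..<p}" "x' \<in> {0..<p}" and y: "y \<in> {0..<p}" "y' \<in> {0..<p}"
      and ne: "x \<noteq> x' \<or> y \<noteq> y'" for x y x' y'
  proof (cases "x = x'")
    case True
    have "incident p (Affine x y) w \<and> incident p (Affine x' y') w \<longleftrightarrow> w = Slope x"
      if "w \<in> plane_points p" for w
    proof (cases w)
      case (Affine m b)
      \<comment> \<open>No line with a slope passes through two distinct points with equal first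
        coordinate, which leaves the vertical one.\<close>
      have False if "[y + b = m * x] (mod p)" "[y' + b = m * x] (mod p)"
      proof -
        have "[y + b = y' + b] (mod p)" using that by (metis cong_sym cong_trans)
        then have "[y = y'] (mod p)" by (simp add: cong_add_rcancel)
        then show False using y ne True by (auto simp: cong_def)
      qed
      then show ?thesis using Affine True by auto
    qed (use True in auto)
    moreover have "Slope x \<in> plane_points p" using x by simp
    ultimately show ?thesis by metis
  next
    case False
    have "\<not> p dvd x - x'" using x False by (auto simp: zdvd_not_zless dest: zdvd_imp_le)
        (metis atLeastLessThan_iff mod_eq_dvd_iff mod_pos_pos_trivial)
    then have cop: "coprime (x - x') p" using p by (metis coprime_commute prime_imp_coprime)
    then obtain z where z: "[(x - x') * z = 1] (mod p)" using cong_solve_coprime_int by blast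
    \<comment> \<open>The slope is \<open>(y - y') / (x - x')\<close>, with \<open>z\<close> as the
      inverse of the denominator; the intercept then follows from the line equation
      \<open>y = m x - b\<close> at the first point.\<close>
    define m where "m = z * (y - y') mod p"
    define b where "b = (m * x - y) mod p"
    have m: "m \<in> {0..<p}" and b: "b \<in> {0..<p}" using p0 by (auto simp: m_def b_def)
    have "[(x - x') * m = (x - x') * (z * (y - y'))] (mod p)"
      unfolding m_def by (intro cong_scalar_left) (simp add: cong_def)
    also have "(x - x') * (z * (y - y')) = ((x - x') * z) * (y - y')" by simp
    also have "[\<dots> = 1 * (y - y')] (mod p)" using z by (rule cong_scalar_right)
    finally have mm: "[(x - x') * m = y - y'] (mod p)" by simp
    have b1: "[y + b = m * x] (mod p)" using b by (simp add: cong_affine_iff b_def)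
    have "[(y + b) - (y - y') = m * x - (x - x') * m] (mod p)"
      using b1 cong_sym[OF mm] by (rule cong_diff)
    then have b2: "[y' + b = m * x'] (mod p)" by (simp add: algebra_simps)
    show ?thesis
    proof (rule ex1I[of _ "Affine m b"])
      show "Affine m b \<in> plane_points p \<and> incident p (Affine x y) (Affine m b) \<and>
          incident p (Affine x' y') (Affine m b)" using m b b1 b2 by simp
      fix w assume w: "w \<in> plane_points p \<and> incident p (Affine x y) w \<and> incident p (Affine x' y') w"
      then obtain m' b' where w': "w = Affine m' b'" using False by (cases w) auto
      have c: "[y + b' = m' * x] (mod p)" "[y' + b' = m' * x'] (mod p)" using w w' by auto
      \<comment> \<open>Subtracting the two line equations removes the intercept, so the slope is
        determined by cancelling the unit \<open>x - x'\<close>.\<close>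
      from cong_diff[OF this] have "[y - y' = (x - x') * m'] (mod p)" by (simp add: algebra_simps)
      with mm have "[(x - x') * m = (x - x') * m'] (mod p)" by (metis cong_trans)
      then have "[m = m'] (mod p)" using cop by (simp add: cong_mult_lcancel)
      then have "m = m'" using m w w' by (auto simp: cong_def)
      moreover have "b = b'" using c(1) w w' calculation by (auto simp: b_def cong_affine_iff)
      ultimately show "w = Affine m b" using w' by simp
    qed
  qed
  show ?thesis
  proof (cases u; cases v)
    fix x y x' y' assume "u = Affine x y" "v = Affine x' y'"
    then show ?thesis using aff[of x x' y y'] uv by auto
  next
    fix x y a assume "u = Affine x y" "v = Slope a"
    then show ?thesis using uv affine_slope[of a x y] by simp
  next
    fix x y a assume "v = Affine x y" "u = Slope a"
    then show ?thesis using uv affine_slope[of a x y] by (simp add: conj_commute)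
  next
    fix x y assume "u = Affine x y" "v = Infinity"
    then show ?thesis using uv affine_infinity[of x y] by simp
  next
    fix x y assume "v = Affine x y" "u = Infinity"
    then show ?thesis using uv affine_infinity[of x y] by (simp add: conj_commute)
  next
    fix a a' assume "u = Slope a" "v = Slope a'"
    then show ?thesis
      using uv by (intro unique[of Infinity]) (auto elim: incident.elims)
  next
    fix a assume "u = Slope a" "v = Infinity"
    then show ?thesis
      using uv by (intro unique[of Infinity]) (auto elim: incident.elims)
  next
    fix a assume "u = Infinity" "v = Slope a"
    then show ?thesis
      using uv by (intro unique[of Infinity]) (auto elim: incident.elims)
  qed (use uv in auto)
qed

text \<open>A plane of order \<open>p\<close> has \<open>p + 1\<close> points on every line and
  \<open>p + 1\<close> lines through every point, and the symmetric coding of lines by points makes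
  it an instance of \<open>polarity_sharp\<close>.\<close>

lemma projective_plane_sharp:
  assumes "prime p"
  shows "\<exists>(G :: (nat, nat \<times> nat) pre_digraph) vs. conn_graph_min_degree G vs (p + 1) \<and>
    largest_eigenvalue (nbhd_laplacian G vs (2 * k)) =
      1 - (real (p + 1) - 1) ^ k / real (p + 1) ^ (2 * k)"
proof (rule polarity_sharp[of "plane_points (int p)" _ "incident (int p)"])
  show "finite (plane_points (int p))" by (rule finite_plane_points)
  show "plane_points (int p) \<noteq> {}" using mem_plane_points(3) by blast
  show "3 \<le> p + 1" using prime_ge_2_nat[OF assms] by simp
  show "incident (int p) y x" if "incident (int p) x y" for x y using that by (rule incident_sym)
  show "card {y \<in> plane_points (int p). incident (int p) x y} = p + 1"
    if "x \<in> plane_points (int p)" for x using card_incident[of p x] prime_gt_0_nat[OF assms] that by simp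
  show "card {z \<in> plane_points (int p). incident (int p) x z \<and> incident (int p) y z} = 1"
    if "x \<in> plane_points (int p)" "y \<in> plane_points (int p)" "x \<noteq> y" for x y
  proof -
    have "prime (int p)" using assms by simp
    from ex1_common_incident[OF this that]
    obtain z where "{z. z \<in> plane_points (int p) \<and> incident (int p) x z \<and> incident (int p) y z} = {z}"
      by (auto simp: set_eq_iff Ex1_def)
    then show ?thesis by simp
  qed
qed

theorem theorem1p3:
  shows
    "(\<forall>(G :: ('a, 'b) pre_digraph) vs d l. conn_graph_min_degree G vs d \<and> 1 \<le> l \<longrightarrow>
        (\<exists>ev. eigenvalue (nbhd_laplacian G vs l) ev \<and> \<bar>1 - ev\<bar> \<le> (sqrt (real d - 1) / real d) ^ l))
   \<and> (\<forall>(G :: ('a, 'b) pre_digraph) vs d k. conn_graph_min_degree G vs d \<and> 1 \<le> k \<longrightarrow>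
        1 - (real d - 1) ^ k / real d ^ (2 * k) \<le> largest_eigenvalue (nbhd_laplacian G vs (2 * k)) \<and>
        largest_eigenvalue (nbhd_laplacian G vs (2 * k)) \<le> 1)
   \<and> (\<forall>k \<ge> 1. infinite {d. \<exists>(G :: (nat, nat \<times> nat) pre_digraph) vs. conn_graph_min_degree G vs d \<and>
        largest_eigenvalue (nbhd_laplacian G vs (2 * k)) = 1 - (real d - 1) ^ k / real d ^ (2 * k)})
   \<and> (\<forall>k \<ge> 1. \<forall>d \<ge> 3. \<exists>(G :: (nat, nat \<times> nat) pre_digraph) vs. conn_graph_min_degree G vs d \<and>
        largest_eigenvalue (nbhd_laplacian G vs (2 * k)) = 1)"
proof (intro conjI allI impI; (elim conjE)?)
  fix k :: nat assume "k \<ge> 1"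
  let ?D = "{d. \<exists>(G :: (nat, nat \<times> nat) pre_digraph) vs. conn_graph_min_degree G vs d \<and>
        largest_eigenvalue (nbhd_laplacian G vs (2 * k)) = 1 - (real d - 1) ^ k / real d ^ (2 * k)}"
  \<comment> \<open>The planes provide extremal graphs for the degrees \<open>p + 1\<close> with
    \<open>p\<close> prime, hence for infinitely many \<open>d\<close>.\<close>
  have "infinite (Suc ` {p :: nat. prime p})"
    using primes_infinite by (simp add: finite_image_iff)
  moreover have "Suc ` {p. prime p} \<subseteq> ?D"
    using projective_plane_sharp[of _ k] by auto
  ultimately show "infinite ?D" by (rule infinite_super[rotated])
qed (simp_all add: nbhd_laplacian_eigenvalue_near_1 nbhd_laplacian_even_largest_eigenvalue_bounds
    complete_bipartite_sharp)

end
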